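(* There exists an $(\varepsilon,\delta)$-differentially private algorithm $\mathrm{PSGE}(X;\vec c,r,\alpha_\mu,\alpha_\sigma,\beta,\varepsilon,\delta)$ with the following guarantee. Suppose $B_r(\vec c)\subseteq\mathbb R^\ell$ is a ball (center $\vec c$, radius $r$), $X_1,\dots,X_n\sim\mathcal N(\mu,\sigma^2I_{\ell\times\ell})$ are independent, and $n\ge\frac{6\ln(5/\beta)}{\varepsilon}+n_\mu+n_\sigma$, where \begin{align*} n_\mu&=O\Big(\frac{\ell}{\alpha_\mu^2}+\frac{\ln(1/\beta)}{\alpha_\mu^2}+\frac{r\ln(1/\beta)}{\alpha_\mu\varepsilon\sigma}+\frac{r\sqrt{\ell\ln(1/\delta)}}{\alpha_\mu\varepsilon\sigma}\Big),\\ n_\sigma&=O\Big(\frac{\ln(1/\beta)}{\alpha_\sigma^2\ell}+\frac{\ln(1/\beta)}{\alpha_\sigma\varepsilon}+\frac{r^2\ln(1/\beta)}{\alpha_\sigma\varepsilon\sigma^2\ell}\Big). \end{align*} Then with probability at least $1-\beta$ the algorithm returns $\hat\mu,\hat\sigma$ such that, if every $X_i$ lies in $B_r(\vec c)$ and $\ell\ge8\ln(10/\beta)$, then \[\|\mu-\hat\mu\|_2\le\alpha_\mu\sigma\qquad\text{and}\qquad 1-\alpha_\sigma\le\frac{\hat\sigma^2}{\sigma^2}\le1+\alpha_\sigma.\]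
   Context: An algorithm $M$ is $(\varepsilon,\delta)$-differentially private if for all datasets $X,X'$ differing in one entry and all events $Y$, $\Pr[M(X)\in Y]\le e^\varepsilon\Pr[M(X')\in Y]+\delta$; privacy is required for all input datasets (including their size).
   Formalization: The constants in the O-terms are uniform for ε bounded above and for β, δ bounded away from 1 (arbitrary bounds, one algorithm for all); with constants uniform over all ε the claim is false, by a packing argument with n=1 and ε=ℓ^{3/4}. *)

theory Defs
  imports "HOL-Probability.Probability"
begin

text \<open>
  The dimension \<open>l\<close> is quantified inside the theorem, because the constants hidden in the
  \<open>O\<close>-terms must not depend on it. So R^l is not a type here: a vector is a function on
  \<open>{..<l}\<close>, \<^const>\<open>undefined\<close> elsewhere, and \<open>vec_space l\<close> carries
  the Borel sets of R^l.
\<close>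

type_synonym rvec = "nat \<Rightarrow> real"

definition vec_space :: "nat \<Rightarrow> rvec measure" where
  "vec_space l = Pi\<^sub>M {..<l} (\<lambda>_. borel)"

definition vec_dist :: "nat \<Rightarrow> rvec \<Rightarrow> rvec \<Rightarrow> real" where
  "vec_dist l x y = L2_set (\<lambda>i. x i - y i) {..<l}"

definition vec_ball :: "nat \<Rightarrow> rvec \<Rightarrow> real \<Rightarrow> rvec set" where
  "vec_ball l c r = {x \<in> space (vec_space l). vec_dist l c x \<le> r}"

text \<open>N(mu, sigma^2 I): the coordinates are independent, and the \<open>i\<close>-th one has mean
  \<open>mu i\<close> and standard deviation \<open>sd\<close>.\<close>

definition spherical_gaussian :: "nat \<Rightarrow> rvec \<Rightarrow> real \<Rightarrow> rvec measure" where
  "spherical_gaussian l mu sd =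
     Pi\<^sub>M {..<l} (\<lambda>i. density lborel (\<lambda>t. ennreal (normal_density (mu i) sd t)))"

definition gaussian_sample :: "nat \<Rightarrow> nat \<Rightarrow> rvec \<Rightarrow> real \<Rightarrow> (nat \<Rightarrow> rvec) measure" where
  "gaussian_sample n l mu sd = Pi\<^sub>M {..<n} (\<lambda>_. spherical_gaussian l mu sd)"

text \<open>Two datasets differ in one entry if one entry is replaced, inserted or deleted. Insertion and
  deletion are included because the size of the dataset is to be kept private as well.\<close>

definition neighbouring :: "'a list \<Rightarrow> 'a list \<Rightarrow> bool" where
  "neighbouring X X' \<longleftrightarrow>
     (\<exists>us vs x y. X = us @ x # vs \<and> X' = us @ y # vs) \<or>
     (\<exists>us vs x. X = us @ x # vs \<and> X' = us @ vs) \<or>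
     (\<exists>us vs x. X = us @ vs \<and> X' = us @ x # vs)"

text \<open>A randomized algorithm maps a dataset, of any size, over the measurable space \<open>D\<close>
  to a probability distribution on the output space \<open>R\<close>, measurably in the entries.\<close>

definition randomized_algorithm ::
    "'a measure \<Rightarrow> 'b measure \<Rightarrow> ('a list \<Rightarrow> 'b measure) \<Rightarrow> bool" where
  "randomized_algorithm D R M \<longleftrightarrow>
     (\<forall>n. (\<lambda>x. M (map x [0..<n])) \<in> Pi\<^sub>M {..<n} (\<lambda>_. D) \<rightarrow>\<^sub>M prob_algebra R)"

definition differentially_private ::
    "'a measure \<Rightarrow> 'b measure \<Rightarrow> real \<Rightarrow> real \<Rightarrow> ('a list \<Rightarrow> 'b measure) \<Rightarrow> bool" where
  "differentially_private D R eps delta M \<longleftrightarrow>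
     (\<forall>X\<in>lists (space D). \<forall>X'\<in>lists (space D). neighbouring X X' \<longrightarrow>
        (\<forall>Y\<in>sets R. measure (M X) Y \<le> exp eps * measure (M X') Y + delta))"

text \<open>The output is the pair of the mean estimate and the estimate of the standard deviation.\<close>

abbreviation output_space :: "nat \<Rightarrow> (rvec \<times> real) measure" where
  "output_space l \<equiv> vec_space l \<Otimes>\<^sub>M borel"

text \<open>Joint distribution of \<open>n\<close> independent Gaussian points and the output of \<open>M\<close>
  on the dataset that they form.\<close>

definition run_on_gaussian ::
    "nat \<Rightarrow> nat \<Rightarrow> rvec \<Rightarrow> real \<Rightarrow> (rvec list \<Rightarrow> (rvec \<times> real) measure) \<Rightarrow>
     ((nat \<Rightarrow> rvec) \<times> (rvec \<times> real)) measure" where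
  "run_on_gaussian n l mu sd M =
     gaussian_sample n l mu sd \<bind> (\<lambda>x. M (map x [0..<n]) \<bind>
       (\<lambda>out. return (Pi\<^sub>M {..<n} (\<lambda>_. vec_space l) \<Otimes>\<^sub>M output_space l) (x, out)))"

text \<open>
  The expressions inside the \<open>O\<close>-terms. The theorem reads the \<open>O\<close> as follows: the
  constants are uniform in all parameters as long as \<open>eps\<close> stays bounded and
  \<open>beta\<close>, \<open>delta\<close> stay bounded away from 1; the bounds are arbitrary, and the algorithm
  does not depend on them. A constant uniform in all \<open>eps\<close> does not exist.
\<close>

definition mu_rate ::
    "nat \<Rightarrow> real \<Rightarrow> real \<Rightarrow> real \<Rightarrow> real \<Rightarrow> real \<Rightarrow> real \<Rightarrow> real" where
  "mu_rate l r alpha_mu beta eps delta sd =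
     real l / alpha_mu\<^sup>2
     + ln (1 / beta) / alpha_mu\<^sup>2
     + r * ln (1 / beta) / (alpha_mu * eps * sd)
     + r * sqrt (real l * ln (1 / delta)) / (alpha_mu * eps * sd)"

definition sigma_rate ::
    "nat \<Rightarrow> real \<Rightarrow> real \<Rightarrow> real \<Rightarrow> real \<Rightarrow> real \<Rightarrow> real" where
  "sigma_rate l r alpha_sigma beta eps sd =
     ln (1 / beta) / (alpha_sigma\<^sup>2 * real l)
     + ln (1 / beta) / (alpha_sigma * eps)
     + r\<^sup>2 * ln (1 / beta) / (alpha_sigma * eps * sd\<^sup>2 * real l)"

definition valid_params ::
    "nat \<Rightarrow> rvec \<Rightarrow> real \<Rightarrow> real \<Rightarrow> real \<Rightarrow> real \<Rightarrow> real \<Rightarrow> real \<Rightarrow> bool" where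
  "valid_params l c r alpha_mu alpha_sigma beta eps delta \<longleftrightarrow>
     1 \<le> l \<and> c \<in> space (vec_space l) \<and> 0 < r \<and> 0 < alpha_mu \<and> 0 < alpha_sigma \<and>
     0 < beta \<and> beta < 1 \<and> 0 < eps \<and> 0 < delta \<and> delta < 1"

end

theory Submission
  imports Defs
begin

text \<open>
  Points outside the ball are replaced by its center. The algorithm perturbs three symmetric
  statistics: the sum of the deviations from the center (Gaussian noise), the size and the total
  scatter around the sample mean (Laplace noise). Inserting a point u into n points of mean V/n
  raises the scatter by n/(n+1) |u - V/n|^2, which is at most 4 r^2, and so the scatter is released
  with pure privacy and n_sigma does not depend on delta.

  If all points lie in the ball, the error splits into sampling and noise terms.
  Chernoff bounds control the chi-square variable |X_1 - mu|^2 + ... + |X_n - mu|^2,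
  the norm of the sum of the X_i - mu and the norm of the Gaussian noise.
  As l is at least 8 ln (10/beta), the squares of the two norms are at most 4 l times the variance
  of a coordinate, except with probability beta/10 each.
\<close>

section \<open>Gaussian vectors and samples\<close>

text \<open>The ball is never conditioned on. If all points lie in it, no point is replaced, so
  accuracy is a deterministic consequence of tail events of an unconditioned Gaussian sample and of
  the noise. Six such events, each of probability at most beta/10, are excluded. The scatter is
  taken around the sample mean and not around c because it is then invariant under translation: in
  the ball it can be recomputed around the unknown mu, and the distance from mu to c drops out.
  Since the size is private, both estimates divide by a noisy count. Its relative error times the
  bound r on the mean deviation is the source of the term r ln(1/beta) / (alpha_mu eps sigma). The
  bounds on eps, beta and delta enter at three places. The Gaussian scale has eps next to
  ln(1/delta) under the root. The thresholds involve ln(10/beta) where the rates have ln(1/beta).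
  The difference between scatter around the sample mean and around mu costs 48 <= alpha_sigma n,
  which is extracted from ln(1/beta) / (alpha_sigma eps) with eps bounded above and ln(1/beta)
  bounded below.\<close>

abbreviation gaussian :: "real \<Rightarrow> real \<Rightarrow> real measure" where
  "gaussian m s \<equiv> density lborel (\<lambda>t. ennreal (normal_density m s t))"

text \<open>Completing the square turns an exponential moment into a constant multiple of another
  normal density, which has mass 1. Both moments below arise in this way, without integrability
  conditions.\<close>

lemma nn_integral_gaussian_eq:
  assumes s: "0 < s" "0 < s'" and f: "f \<in> borel_measurable borel"
    and eq: "\<And>t. f t * ennreal (normal_density m s t) = K * ennreal (normal_density m' s' t)"
  shows "(\<integral>\<^sup>+ t. f t \<partial>gaussian m s) = K"
proof -
  have "(\<integral>\<^sup>+ t. f t \<partial>gaussian m s) = (\<integral>\<^sup>+ t. K * ennreal (normal_density m' s' t) \<partial>lborel)"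
    using f by (subst nn_integral_density) (auto simp: eq[symmetric] mult.commute)
  also have "\<dots> = K * (\<integral>\<^sup>+ t. ennreal (normal_density m' s' t) \<partial>lborel)"
    by (rule nn_integral_cmult) auto
  also have "(\<integral>\<^sup>+ t. ennreal (normal_density m' s' t) \<partial>lborel) = 1"
    using prob_space.emeasure_space_1[OF prob_space_normal_density[OF s(2), of m']]
    by (simp add: emeasure_density)
  finally show ?thesis by simp
qed

text \<open>Tilting by a linear form moves the mean by \<open>c * s\<^sup>2\<close> and keeps the
  variance.\<close>

lemma gaussian_exp_linear:
  assumes "0 < s"
  shows "(\<integral>\<^sup>+ t. ennreal (exp (c * (t - m))) \<partial>gaussian m s) = ennreal (exp (c\<^sup>2 * s\<^sup>2 / 2))"
proof (rule nn_integral_gaussian_eq[where m' = "m + c * s\<^sup>2" and s' = s])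
  fix t
  have "c * (t - m) + (- (t - m)\<^sup>2 / (2 * s\<^sup>2)) = c\<^sup>2 * s\<^sup>2 / 2 + (- (t - (m + c * s\<^sup>2))\<^sup>2 / (2 * s\<^sup>2))"
    using assms by (simp add: field_simps power2_eq_square)
  then have "exp (c * (t - m)) * exp (- (t - m)\<^sup>2 / (2 * s\<^sup>2)) =
      exp (c\<^sup>2 * s\<^sup>2 / 2) * exp (- (t - (m + c * s\<^sup>2))\<^sup>2 / (2 * s\<^sup>2))"
    by (simp only: exp_add[symmetric])
  then show "ennreal (exp (c * (t - m))) * ennreal (normal_density m s t) =
      ennreal (exp (c\<^sup>2 * s\<^sup>2 / 2)) * ennreal (normal_density (m + c * s\<^sup>2) s t)"
    by (simp add: normal_density_def ennreal_mult[symmetric] mult_ac)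
qed (use assms in auto)

text \<open>Tilting by a square keeps the mean and rescales the standard deviation by
  \<open>1 / sqrt (1 - 2 * u)\<close>. Negative \<open>u\<close> is included because the lower tail
  of the chi-square variable is obtained from it.\<close>

lemma gaussian_exp_square:
  assumes s: "0 < s" and u: "u < 1 / 2"
  shows "(\<integral>\<^sup>+ t. ennreal (exp (u * ((t - m)\<^sup>2 / s\<^sup>2))) \<partial>gaussian m s) = ennreal (1 / sqrt (1 - 2 * u))"
proof (rule nn_integral_gaussian_eq[where m' = m and s' = "s / sqrt (1 - 2 * u)"])
  fix t
  define q where "q = sqrt (1 - 2 * u)"
  have q: "0 < q" "q\<^sup>2 = 1 - 2 * u" using u by (auto simp: q_def)
  have "u * ((t - m)\<^sup>2 / s\<^sup>2) + (- (t - m)\<^sup>2 / (2 * s\<^sup>2)) = - ((t - m)\<^sup>2 * (1 - 2 * u)) / (2 * s\<^sup>2)"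
    using s by (simp add: field_simps)
  also have "\<dots> = - (t - m)\<^sup>2 / (2 * (s / q)\<^sup>2)"
    unfolding q(2)[symmetric] using s q by (simp add: field_simps)
  finally have e: "exp (u * ((t - m)\<^sup>2 / s\<^sup>2)) * exp (- (t - m)\<^sup>2 / (2 * s\<^sup>2)) = exp (- (t - m)\<^sup>2 / (2 * (s / q)\<^sup>2))"
    by (simp only: exp_add[symmetric])
  have r: "1 / sqrt (2 * pi * (s / q)\<^sup>2) = q * (1 / sqrt (2 * pi * s\<^sup>2))"
    using s q by (simp add: real_sqrt_mult real_sqrt_divide)
  have "exp (u * ((t - m)\<^sup>2 / s\<^sup>2)) * normal_density m s t = 1 / q * normal_density m (s / q) t"
    unfolding normal_density_def r e[symmetric] using q(1) by simp
  then show "ennreal (exp (u * ((t - m)\<^sup>2 / s\<^sup>2))) * ennreal (normal_density m s t) =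
      ennreal (1 / sqrt (1 - 2 * u)) * ennreal (normal_density m (s / sqrt (1 - 2 * u)) t)"
    unfolding q_def[symmetric] using q(1) by (simp add: ennreal_mult[symmetric])
qed (use assms in auto)

lemma prob_space_gaussian: "0 < s \<Longrightarrow> prob_space (gaussian m s)"
  by (rule prob_space_normal_density)

lemma space_vec_space: "space (vec_space l) = PiE {..<l} (\<lambda>_. UNIV)"
  by (simp add: vec_space_def space_PiM)

lemma sets_spherical_gaussian [simp, measurable_cong]:
  "sets (spherical_gaussian l mu sd) = sets (vec_space l)"
  unfolding spherical_gaussian_def vec_space_def by (rule sets_PiM_cong) auto

lemma space_spherical_gaussian [simp]: "space (spherical_gaussian l mu sd) = space (vec_space l)"
  by (rule sets_eq_imp_space_eq) simp

lemma sets_gaussian_sample [simp, measurable_cong]: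
  "sets (gaussian_sample n l mu sd) = sets (Pi\<^sub>M {..<n} (\<lambda>_. vec_space l))"
  unfolding gaussian_sample_def by (rule sets_PiM_cong) auto

lemma space_gaussian_sample [simp]:
  "space (gaussian_sample n l mu sd) = space (Pi\<^sub>M {..<n} (\<lambda>_. vec_space l))"
  by (rule sets_eq_imp_space_eq) simp

lemma prob_space_spherical_gaussian: "0 < sd \<Longrightarrow> prob_space (spherical_gaussian l mu sd)"
  unfolding spherical_gaussian_def by (intro prob_space_PiM prob_space_gaussian)

lemma prob_space_gaussian_sample: "0 < sd \<Longrightarrow> prob_space (gaussian_sample n l mu sd)"
  unfolding gaussian_sample_def by (intro prob_space_PiM prob_space_spherical_gaussian)

lemma nn_integral_spherical_gaussian_prod:
  assumes "0 < sd" and "\<And>k. k < l \<Longrightarrow> f k \<in> borel_measurable borel"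
  shows "(\<integral>\<^sup>+ x. (\<Prod>k<l. f k (x k)) \<partial>spherical_gaussian l mu sd) =
    (\<Prod>k<l. \<integral>\<^sup>+ t. f k t \<partial>gaussian (mu k) sd)"
proof -
  interpret product_prob_space "\<lambda>k. gaussian (mu k) sd"
    by (rule product_prob_spaceI) (rule prob_space_gaussian[OF assms(1)])
  show ?thesis
    unfolding spherical_gaussian_def by (rule product_nn_integral_prod) (use assms in auto)
qed

lemma measurable_vec_component [measurable (raw)]:
  "k < l \<Longrightarrow> (\<lambda>x. x k) \<in> vec_space l \<rightarrow>\<^sub>M borel"
  unfolding vec_space_def using measurable_component_singleton[of k "{..<l}" "\<lambda>_. borel"] by simp

lemma measurable_vec_component' [measurable_dest]:
  assumes "f \<in> N \<rightarrow>\<^sub>M vec_space l" and "g \<in> L \<rightarrow>\<^sub>M N" and "k < l"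
  shows "(\<lambda>x. f (g x) k) \<in> borel_measurable L"
  using assms by (intro measurable_compose[OF assms(2)] measurable_compose[OF assms(1)] measurable_vec_component)

lemma measurable_sample_component [measurable (raw)]:
  "i < n \<Longrightarrow> k < l \<Longrightarrow> (\<lambda>x. x i k) \<in> Pi\<^sub>M {..<n} (\<lambda>_. vec_space l) \<rightarrow>\<^sub>M borel"
  using measurable_compose[OF measurable_component_singleton[of i "{..<n}" "\<lambda>_. vec_space l"] measurable_vec_component]
  by simp

text \<open>All \<open>n * l\<close> coordinates are independent; this reduces the exponential
  moments of the sample to one-dimensional integrals.\<close>

lemma nn_integral_gaussian_sample_prod:
  assumes "0 < sd" and f: "\<And>i k. i < n \<Longrightarrow> k < l \<Longrightarrow> f i k \<in> borel_measurable borel"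
  shows "(\<integral>\<^sup>+ x. (\<Prod>i<n. \<Prod>k<l. f i k (x i k)) \<partial>gaussian_sample n l mu sd) =
    (\<Prod>i<n. \<Prod>k<l. \<integral>\<^sup>+ t. f i k t \<partial>gaussian (mu k) sd)"
proof -
  interpret product_prob_space "\<lambda>i::nat. spherical_gaussian l mu sd"
    by (rule product_prob_spaceI) (rule prob_space_spherical_gaussian[OF assms(1)])
  have "(\<integral>\<^sup>+ x. (\<Prod>i<n. \<Prod>k<l. f i k (x i k)) \<partial>gaussian_sample n l mu sd) =
      (\<Prod>i<n. \<integral>\<^sup>+ y. (\<Prod>k<l. f i k (y k)) \<partial>spherical_gaussian l mu sd)"
    unfolding gaussian_sample_def
    by (rule product_nn_integral_prod)
       (auto intro!: borel_measurable_prod_ennreal measurable_compose[OF _ f])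
  also have "\<dots> = (\<Prod>i<n. \<Prod>k<l. \<integral>\<^sup>+ t. f i k t \<partial>gaussian (mu k) sd)"
    by (intro prod.cong nn_integral_spherical_gaussian_prod assms) auto
  finally show ?thesis .
qed

text \<open>The Chernoff parameter is absorbed into \<open>f\<close>; each application first
  rescales its event accordingly.\<close>

lemma emeasure_Chernoff:
  assumes [measurable]: "f \<in> borel_measurable M"
    and "(\<integral>\<^sup>+ x. ennreal (exp (f x)) \<partial>M) \<le> ennreal (exp b)"
  shows "emeasure M {x \<in> space M. a \<le> f x} \<le> ennreal (exp (b - a))"
proof -
  have "emeasure M {x \<in> space M. a \<le> f x} \<le>
      ennreal (exp (- 1 * a)) * (\<integral>\<^sup>+ x. ennreal (exp (1 * f x)) * indicator (space M) x \<partial>M)"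
    by (rule Chernoff_ineq_nn_integral_ge) auto
  also have "(\<integral>\<^sup>+ x. ennreal (exp (1 * f x)) * indicator (space M) x \<partial>M) = (\<integral>\<^sup>+ x. ennreal (exp (f x)) \<partial>M)"
    by (intro nn_integral_cong) auto
  also have "ennreal (exp (- 1 * a)) * (\<integral>\<^sup>+ x. ennreal (exp (f x)) \<partial>M) \<le> ennreal (exp (- 1 * a)) * ennreal (exp b)"
    by (intro mult_left_mono assms) auto
  also have "\<dots> = ennreal (exp (b - a))"
    by (simp add: ennreal_mult[symmetric] exp_add[symmetric])
  finally show ?thesis .
qed

section \<open>Concentration of the sample\<close>

definition sq_dev :: "nat \<Rightarrow> nat \<Rightarrow> rvec \<Rightarrow> (nat \<Rightarrow> rvec) \<Rightarrow> real" where
  "sq_dev n l mu x = (\<Sum>i<n. \<Sum>k<l. (x i k - mu k)\<^sup>2)"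

lemma measurable_sq_dev [measurable]:
  "sq_dev n l mu \<in> borel_measurable (Pi\<^sub>M {..<n} (\<lambda>_. vec_space l))"
  unfolding sq_dev_def [abs_def] by measurable

text \<open>The scaled \<open>sq_dev\<close> is chi-square with \<open>n * l\<close> degrees of
  freedom. Its moment generating function is written as an exponential, so that elementary bounds on
  the logarithm give the tails.\<close>

lemma nn_integral_exp_sq_dev:
  assumes sd: "0 < sd" and u: "u < 1 / 2"
  shows "(\<integral>\<^sup>+ x. ennreal (exp (u * (sq_dev n l mu x / sd\<^sup>2))) \<partial>gaussian_sample n l mu sd) =
    ennreal (exp (- (real (n * l) / 2) * ln (1 - 2 * u)))"
proof -
  have "(\<integral>\<^sup>+ x. ennreal (exp (u * (sq_dev n l mu x / sd\<^sup>2))) \<partial>gaussian_sample n l mu sd) =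
      (\<integral>\<^sup>+ x. (\<Prod>i<n. \<Prod>k<l. ennreal (exp (u * ((x i k - mu k)\<^sup>2 / sd\<^sup>2)))) \<partial>gaussian_sample n l mu sd)"
    by (simp add: sq_dev_def sum_divide_distrib sum_distrib_left exp_sum prod_ennreal prod_nonneg)
  also have "\<dots> = (\<Prod>i<n. \<Prod>k<l. ennreal (1 / sqrt (1 - 2 * u)))"
    by (subst nn_integral_gaussian_sample_prod[where f = "\<lambda>i k t. ennreal (exp (u * ((t - mu k)\<^sup>2 / sd\<^sup>2)))"])
       (use assms in \<open>simp_all only: gaussian_exp_square, auto\<close>)
  also have "\<dots> = ennreal ((1 / sqrt (1 - 2 * u)) ^ (n * l))"
    using u by (simp add: ennreal_power power_mult[symmetric] mult.commute)
  also have "1 / sqrt (1 - 2 * u) = exp (- (ln (1 - 2 * u) / 2))"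
    using u by (simp add: exp_minus ln_sqrt[symmetric] inverse_eq_divide)
  also have "exp (- (ln (1 - 2 * u) / 2)) ^ (n * l) = exp (- (real (n * l) / 2) * ln (1 - 2 * u))"
    by (simp add: exp_of_nat_mult[symmetric])
  finally show ?thesis .
qed

text \<open>The chi-square upper tail is Gaussian for small \<open>a\<close> and only exponential
  for large \<open>a\<close>; the minimum covers both regimes, as the accuracy parameter may exceed
  1.\<close>

lemma sq_dev_upper_tail:
  assumes sd: "0 < sd" and a: "0 \<le> a"
  shows "emeasure (gaussian_sample n l mu sd)
      {x \<in> space (gaussian_sample n l mu sd). real (n * l) * (1 + a) \<le> sq_dev n l mu x / sd\<^sup>2}
    \<le> ennreal (exp (- (min a 1 * a * real (n * l) / 16)))"
proof -
  define N where "N = real (n * l)"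
  \<comment> \<open>\<open>8 * u \<le> a\<close> makes the loss \<open>4 * u\<^sup>2\<close> at most
    half of the gain \<open>u * a\<close>, and the cap keeps \<open>2 * u\<close> in the range of
    the quadratic lower bound on the logarithm.\<close>
  define u where "u = min a 1 / 8"
  have u: "0 \<le> u" "u \<le> 1 / 8" "8 * u \<le> a" using a by (auto simp: u_def)
  have "- ln (1 - 2 * u) \<le> 2 * u + 2 * (2 * u)\<^sup>2"
    using ln_one_minus_pos_lower_bound[of "2 * u"] u by simp
  then have "N / 2 * (- ln (1 - 2 * u)) \<le> N / 2 * (2 * u + 2 * (2 * u)\<^sup>2)"
    by (intro mult_left_mono) (auto simp: N_def)
  then have ln: "- (N / 2) * ln (1 - 2 * u) \<le> N * (u + 4 * u\<^sup>2)"
    by (simp add: power2_eq_square algebra_simps)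
  have "N * (u * (8 * u)) \<le> N * (u * a)"
    using u by (intro mult_left_mono) (auto simp: N_def)
  then have exponent: "N * (u + 4 * u\<^sup>2) - u * (N * (1 + a)) \<le> - (min a 1 * a * N / 16)"
    by (simp add: u_def power2_eq_square field_simps)
  have "emeasure (gaussian_sample n l mu sd)
      {x \<in> space (gaussian_sample n l mu sd). N * (1 + a) \<le> sq_dev n l mu x / sd\<^sup>2} \<le>
    emeasure (gaussian_sample n l mu sd)
      {x \<in> space (gaussian_sample n l mu sd). u * (N * (1 + a)) \<le> u * (sq_dev n l mu x / sd\<^sup>2)}"
    using u(1) by (intro emeasure_mono) (auto simp del: times_divide_eq_right intro: mult_left_mono)
  also have "\<dots> \<le> ennreal (exp (N * (u + 4 * u\<^sup>2) - u * (N * (1 + a))))"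
    using nn_integral_exp_sq_dev[OF sd, of u n l mu] u ln
    by (intro emeasure_Chernoff) (auto simp: N_def)
  also have "\<dots> \<le> ennreal (exp (- (min a 1 * a * N / 16)))"
    using exponent by simp
  finally show ?thesis unfolding N_def .
qed

lemma sq_dev_lower_tail:
  assumes sd: "0 < sd" and a: "0 \<le> a" "a \<le> 1"
  shows "emeasure (gaussian_sample n l mu sd)
      {x \<in> space (gaussian_sample n l mu sd). sq_dev n l mu x / sd\<^sup>2 \<le> real (n * l) * (1 - a)}
    \<le> ennreal (exp (- (a\<^sup>2 * real (n * l) / 8)))"
proof -
  define N where "N = real (n * l)"
  \<comment> \<open>With the tilt \<open>- u\<close>, the quadratic bound on the logarithm leaves
    the exponent \<open>2 * u\<^sup>2 - u * a\<close> per degree of freedom; this is its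
    minimizer.\<close>
  define u where "u = a / 4"
  have u: "0 \<le> u" "u \<le> 1 / 4" using a by (auto simp: u_def)
  have "2 * u - (2 * u)\<^sup>2 \<le> ln (1 + 2 * u)"
    using ln_one_plus_pos_lower_bound[of "2 * u"] u by simp
  then have "N / 2 * (2 * u - (2 * u)\<^sup>2) \<le> N / 2 * ln (1 + 2 * u)"
    by (intro mult_left_mono) (auto simp: N_def)
  then have ln: "- (N / 2) * ln (1 - 2 * (- u)) \<le> N * (2 * u\<^sup>2 - u)"
    by (simp add: power2_eq_square algebra_simps)
  have exponent: "N * (2 * u\<^sup>2 - u) - (- u * (N * (1 - a))) = - (a\<^sup>2 * N / 8)"
    by (simp add: u_def power2_eq_square field_simps)
  have "emeasure (gaussian_sample n l mu sd)
      {x \<in> space (gaussian_sample n l mu sd). sq_dev n l mu x / sd\<^sup>2 \<le> N * (1 - a)} \<le>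
    emeasure (gaussian_sample n l mu sd)
      {x \<in> space (gaussian_sample n l mu sd). - u * (N * (1 - a)) \<le> - u * (sq_dev n l mu x / sd\<^sup>2)}"
    using u(1) by (intro emeasure_mono) (auto simp del: times_divide_eq_right intro: mult_left_mono)
  also have "\<dots> \<le> ennreal (exp (N * (2 * u\<^sup>2 - u) - (- u * (N * (1 - a)))))"
    using nn_integral_exp_sq_dev[OF sd, of "- u" n l mu] u ln
    by (intro emeasure_Chernoff) (auto simp: N_def)
  finally show ?thesis unfolding exponent unfolding N_def .
qed

text \<open>This is the square tilt with parameter 1/4: each coordinate contributes a factor sqrt
  2.\<close>

lemma nn_integral_exp_norm_spherical_gaussian:
  assumes s: "0 < s"
  shows "(\<integral>\<^sup>+ g. ennreal (exp ((\<Sum>k<l. (g k)\<^sup>2) / (4 * s\<^sup>2))) \<partial>spherical_gaussian l (\<lambda>_. 0) s) =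
    ennreal (exp (real l * ln 2 / 2))"
proof -
  have "(\<integral>\<^sup>+ g. ennreal (exp ((\<Sum>k<l. (g k)\<^sup>2) / (4 * s\<^sup>2))) \<partial>spherical_gaussian l (\<lambda>_. 0) s) =
      (\<integral>\<^sup>+ g. (\<Prod>k<l. ennreal (exp (1 / 4 * ((g k - 0)\<^sup>2 / s\<^sup>2)))) \<partial>spherical_gaussian l (\<lambda>_. 0) s)"
    by (simp add: sum_divide_distrib exp_sum prod_ennreal prod_nonneg mult.commute)
  also have "\<dots> = (\<Prod>k<l. ennreal (1 / sqrt (1 - 2 * (1 / 4))))"
    by (subst nn_integral_spherical_gaussian_prod[where f = "\<lambda>k t. ennreal (exp (1 / 4 * ((t - 0)\<^sup>2 / s\<^sup>2)))"])
       (use assms gaussian_exp_square[of s "1 / 4" 0] in auto)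
  also have "1 / sqrt (1 - 2 * (1 / 4)) = exp (ln 2 / 2)"
    by (simp add: ln_sqrt[symmetric] real_sqrt_divide)
  also have "(\<Prod>k<l. ennreal (exp (ln 2 / 2))) = ennreal (exp (real l * (ln 2 / 2)))"
    by (simp add: ennreal_power exp_of_nat_mult[symmetric])
  finally show ?thesis by simp
qed

lemma ln_2_le_1: "ln 2 \<le> (1 :: real)"
  using ln_add_one_self_le_self[of "1 :: real"] by simp

lemma norm_tail_exponent: "exp (real l * ln 2 / 2 - real l) \<le> exp (- (real l / 2))"
  using mult_left_mono[OF ln_2_le_1, of "real l"] by simp

text \<open>At the threshold the tilted exponent equals \<open>l\<close>, and the moment is only
  2^(l/2). As ln 2 is at most 1, a factor exp (-l/2) remains.\<close>

lemma spherical_gaussian_norm_tail: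
  assumes s: "0 < s"
  shows "emeasure (spherical_gaussian l (\<lambda>_. 0) s)
      {g \<in> space (spherical_gaussian l (\<lambda>_. 0) s). 4 * real l * s\<^sup>2 \<le> (\<Sum>k<l. (g k)\<^sup>2)}
    \<le> ennreal (exp (- (real l / 2)))"
proof -
  let ?G = "spherical_gaussian l (\<lambda>_. 0) s"
  have "emeasure ?G {g \<in> space ?G. 4 * real l * s\<^sup>2 \<le> (\<Sum>k<l. (g k)\<^sup>2)} =
      emeasure ?G {g \<in> space ?G. real l \<le> (\<Sum>k<l. (g k)\<^sup>2) / (4 * s\<^sup>2)}"
    using s by (intro arg_cong2[where f = emeasure] refl Collect_cong) (simp add: field_simps)
  also have "\<dots> \<le> ennreal (exp (real l * ln 2 / 2 - real l))"
    by (intro emeasure_Chernoff) (auto simp: nn_integral_exp_norm_spherical_gaussian[OF s])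
  also have "\<dots> \<le> ennreal (exp (- (real l / 2)))"
    using norm_tail_exponent by (intro ennreal_leI)
  finally show ?thesis .
qed

definition sum_dev :: "nat \<Rightarrow> rvec \<Rightarrow> (nat \<Rightarrow> rvec) \<Rightarrow> rvec" where
  "sum_dev n mu x = (\<lambda>k. \<Sum>i<n. (x i k - mu k))"

lemma measurable_sum_dev [measurable (raw)]:
  assumes [measurable]: "f \<in> M \<rightarrow>\<^sub>M Pi\<^sub>M {..<n} (\<lambda>_. vec_space l)" and "k < l"
  shows "(\<lambda>x. sum_dev n mu (f x) k) \<in> borel_measurable M"
  using \<open>k < l\<close> unfolding sum_dev_def by measurable

text \<open>Writing exp of a square as the mean of exp of a linear form in an auxiliary standard
  Gaussian vector makes the integrand a product over all coordinates of the sample.\<close>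

lemma nn_integral_exp_sum_dev:
  assumes sd: "0 < sd" and n: "0 < n"
  shows "(\<integral>\<^sup>+ x. ennreal (exp ((\<Sum>k<l. (sum_dev n mu x k)\<^sup>2) / (4 * real n * sd\<^sup>2))) \<partial>gaussian_sample n l mu sd) =
    ennreal (exp (real l * ln 2 / 2))"
proof -
  let ?X = "gaussian_sample n l mu sd"
  let ?T = "spherical_gaussian l (\<lambda>_. 0) 1"
  \<comment> \<open>Chosen so that the linear form \<open>c * w * t\<close> averages to exp of
    \<open>w\<^sup>2 / (4 * n * sd\<^sup>2)\<close>. Averaging over the sample then leaves the
    coefficient 1/4 in front of each \<open>(t k)\<^sup>2\<close>, which is the norm moment already
    computed, with scale 1.\<close>
  define c where "c = 1 / (sd * sqrt (2 * n))"
  have c: "c\<^sup>2 * sd\<^sup>2 * real n = 1 / 2"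
    using sd n by (simp add: c_def power_mult_distrib power_divide)
  have c2: "w\<^sup>2 / (4 * real n * sd\<^sup>2) = (c * w)\<^sup>2 * 1\<^sup>2 / 2" for w
    using sd n by (simp add: c_def power_mult_distrib power_divide field_simps)
  interpret X: prob_space ?X by (rule prob_space_gaussian_sample) fact
  interpret T: prob_space ?T by (rule prob_space_spherical_gaussian) simp
  interpret P: pair_sigma_finite ?T ?X ..
  have lin: "(\<integral>\<^sup>+ t. ennreal (exp (a * t)) \<partial>gaussian 0 1) = ennreal (exp (a\<^sup>2 * 1\<^sup>2 / 2))" for a
    using gaussian_exp_linear[of 1 0 a] by (simp only: diff_zero zero_less_one simp_thms)
  have "(\<integral>\<^sup>+ x. ennreal (exp ((\<Sum>k<l. (sum_dev n mu x k)\<^sup>2) / (4 * real n * sd\<^sup>2))) \<partial>?X) =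
      (\<integral>\<^sup>+ x. (\<Prod>k<l. ennreal (exp ((c * sum_dev n mu x k)\<^sup>2 * 1\<^sup>2 / 2))) \<partial>?X)"
    unfolding sum_divide_distrib c2 by (simp add: exp_sum prod_ennreal prod_nonneg)
  also have "\<dots> = (\<integral>\<^sup>+ x. \<integral>\<^sup>+ t. (\<Prod>k<l. ennreal (exp (c * sum_dev n mu x k * t k))) \<partial>?T \<partial>?X)"
    by (subst nn_integral_spherical_gaussian_prod) (simp_all add: lin)
  also have "\<dots> = (\<integral>\<^sup>+ t. \<integral>\<^sup>+ x. (\<Prod>k<l. ennreal (exp (c * sum_dev n mu x k * t k))) \<partial>?X \<partial>?T)"
    by (rule P.Fubini') measurable
  also have "\<dots> = (\<integral>\<^sup>+ t. \<integral>\<^sup>+ x. (\<Prod>i<n. \<Prod>k<l. ennreal (exp (c * t k * (x i k - mu k)))) \<partial>?X \<partial>?T)"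
    by (subst prod.swap)
       (simp add: sum_dev_def prod_ennreal prod_nonneg exp_sum[symmetric] sum_distrib_left sum_distrib_right mult_ac)
  also have "\<dots> = (\<integral>\<^sup>+ t. (\<Prod>i<n. \<Prod>k<l. ennreal (exp ((c * t k)\<^sup>2 * sd\<^sup>2 / 2))) \<partial>?T)"
    by (subst nn_integral_gaussian_sample_prod[OF sd, where f = "\<lambda>i k y. ennreal (exp (c * _ k * (y - mu k)))"])
       (simp_all add: gaussian_exp_linear[OF sd])
  also have "\<dots> = (\<integral>\<^sup>+ t. ennreal (exp ((\<Sum>k<l. (t k)\<^sup>2) / (4 * 1\<^sup>2))) \<partial>?T)"
  proof (intro nn_integral_cong)
    fix t :: rvec
    have "(\<Prod>i<n. \<Prod>k<l. ennreal (exp ((c * t k)\<^sup>2 * sd\<^sup>2 / 2))) =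
        ennreal (exp (real n * (\<Sum>k<l. (c * t k)\<^sup>2 * sd\<^sup>2 / 2)))"
      by (simp add: prod_ennreal prod_nonneg exp_sum[symmetric] ennreal_power exp_of_nat_mult[symmetric])
    also have "real n * (\<Sum>k<l. (c * t k)\<^sup>2 * sd\<^sup>2 / 2) = (c\<^sup>2 * sd\<^sup>2 * real n) / 2 * (\<Sum>k<l. (t k)\<^sup>2)"
      unfolding sum_distrib_left by (intro sum.cong) (simp_all add: power_mult_distrib)
    finally show "(\<Prod>i<n. \<Prod>k<l. ennreal (exp ((c * t k)\<^sup>2 * sd\<^sup>2 / 2))) =
        ennreal (exp ((\<Sum>k<l. (t k)\<^sup>2) / (4 * 1\<^sup>2)))"
      by (simp add: c)
  qed
  also have "\<dots> = ennreal (exp (real l * ln 2 / 2))"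
    by (rule nn_integral_exp_norm_spherical_gaussian) simp
  finally show ?thesis .
qed

lemma sum_dev_tail:
  assumes sd: "0 < sd" and n: "0 < n"
  shows "emeasure (gaussian_sample n l mu sd)
      {x \<in> space (gaussian_sample n l mu sd). 4 * real l * (real n * sd\<^sup>2) \<le> (\<Sum>k<l. (sum_dev n mu x k)\<^sup>2)}
    \<le> ennreal (exp (- (real l / 2)))"
proof -
  let ?G = "gaussian_sample n l mu sd"
  have "emeasure ?G {x \<in> space ?G. 4 * real l * (real n * sd\<^sup>2) \<le> (\<Sum>k<l. (sum_dev n mu x k)\<^sup>2)} =
      emeasure ?G {x \<in> space ?G. real l \<le> (\<Sum>k<l. (sum_dev n mu x k)\<^sup>2) / (4 * real n * sd\<^sup>2)}"
    using sd n by (intro arg_cong2[where f = emeasure] refl Collect_cong) (simp add: field_simps)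
  also have "\<dots> \<le> ennreal (exp (real l * ln 2 / 2 - real l))"
    by (intro emeasure_Chernoff) (auto simp: nn_integral_exp_sum_dev[OF sd n])
  also have "\<dots> \<le> ennreal (exp (- (real l / 2)))"
    using norm_tail_exponent by (intro ennreal_leI)
  finally show ?thesis .
qed

section \<open>Laplace noise and translated Gaussian vectors\<close>

definition laplace :: "real \<Rightarrow> real measure" where
  "laplace b = density lborel (\<lambda>t. ennreal (exp (- \<bar>t\<bar> / b) / (2 * b)))"

lemma sets_laplace [simp, measurable_cong]: "sets (laplace b) = sets borel"
  by (simp add: laplace_def)

lemma space_laplace [simp]: "space (laplace b) = UNIV"
  by (simp add: laplace_def)

text \<open>On the event the density is exp (-y/b) / 2 times the sum of two exponential densities,
  one starting at \<open>y\<close> and one reflected and starting at \<open>- y\<close>. Each has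
  mass 1.\<close>

lemma laplace_tail:
  assumes b: "0 < b" and y: "0 \<le> y"
  shows "emeasure (laplace b) {t. y \<le> \<bar>t\<bar>} = ennreal (exp (- y / b))"
proof -
  let ?E = "\<lambda>t. ennreal (exponential_density (1 / b) t)"
  have E: "(\<integral>\<^sup>+ t. ?E t \<partial>lborel) = 1"
    using prob_space.emeasure_space_1[OF prob_space_exponential_density, of "1 / b"] b
    by (simp add: emeasure_density)
  have E1: "(\<integral>\<^sup>+ t. ?E (t - y) \<partial>lborel) = 1"
    using nn_integral_real_affine[of ?E 1 "- y"] E by simp
  have E2: "(\<integral>\<^sup>+ t. ?E (- t - y) \<partial>lborel) = 1"
  proof -
    have "(\<integral>\<^sup>+ t. ?E (- t - y) \<partial>lborel) = (\<integral>\<^sup>+ t. ?E (- y + (- 1) * t) \<partial>lborel)"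
      by (intro nn_integral_cong arg_cong[where f = ?E]) simp
    also have "\<dots> = ennreal \<bar>- 1\<bar> * (\<integral>\<^sup>+ t. ?E (- y + (- 1) * t) \<partial>lborel)"
      by simp
    also have "\<dots> = (\<integral>\<^sup>+ t. ?E t \<partial>lborel)"
      by (rule nn_integral_real_affine[symmetric]) auto
    finally show ?thesis unfolding E .
  qed
  have "emeasure (laplace b) {t. y \<le> \<bar>t\<bar>} =
      (\<integral>\<^sup>+ t. ennreal (exp (- \<bar>t\<bar> / b) / (2 * b)) * indicator {t. y \<le> \<bar>t\<bar>} t \<partial>lborel)"
    unfolding laplace_def by (rule emeasure_density) auto
  also have "\<dots> = (\<integral>\<^sup>+ t. ennreal (exp (- y / b) / 2) * (?E (t - y) + ?E (- t - y)) \<partial>lborel)"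
  proof (rule nn_integral_cong_AE)
    have pos: "exp (- \<bar>t\<bar> / b) / (2 * b) = exp (- y / b) / 2 * (1 / b * exp (- (\<bar>t\<bar> - y) * (1 / b)))" for t
      using b by (simp add: exp_add[symmetric] field_simps)
    \<comment> \<open>At \<open>t = 0\<close> both exponential densities are positive if
      \<open>y = 0\<close>, so the identity fails at this one point and is claimed almost
      everywhere.\<close>
    have "ennreal (exp (- \<bar>t\<bar> / b) / (2 * b)) * indicator {t. y \<le> \<bar>t\<bar>} t =
        ennreal (exp (- y / b) / 2) * (?E (t - y) + ?E (- t - y))" if "t \<noteq> 0" for t
    proof (cases "y \<le> \<bar>t\<bar>")
      case False
      then have "t - y < 0" "- t - y < 0" by auto
      then show ?thesis using False by (simp add: exponential_density_def)
    next
      case True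
      then have "exponential_density (1 / b) (t - y) + exponential_density (1 / b) (- t - y) =
          1 / b * exp (- (\<bar>t\<bar> - y) * (1 / b))"
        using that y by (cases "0 \<le> t") (auto simp: exponential_density_def)
      then show ?thesis
        using True b by (simp only: pos) (simp add: ennreal_mult[symmetric] ennreal_plus[symmetric] exponential_density_nonneg del: ennreal_plus)
    qed
    moreover have "AE t in lborel. t \<noteq> (0 :: real)" by (rule AE_lborel_singleton)
    ultimately show "AE t in lborel. ennreal (exp (- \<bar>t\<bar> / b) / (2 * b)) * indicator {t. y \<le> \<bar>t\<bar>} t =
        ennreal (exp (- y / b) / 2) * (?E (t - y) + ?E (- t - y))"
      by (auto elim: eventually_mono)
  qed
  also have "\<dots> = ennreal (exp (- y / b) / 2) * (1 + 1)"
    by (simp add: nn_integral_cmult nn_integral_add E1 E2)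
  also have "\<dots> = ennreal (exp (- y / b))"
    by (simp add: one_add_one ennreal_mult[symmetric] flip: ennreal_numeral)
  finally show ?thesis .
qed

text \<open>The total mass is the tail at 0.\<close>

lemma prob_space_laplace: "0 < b \<Longrightarrow> prob_space (laplace b)"
  using laplace_tail[of b 0] by (intro prob_spaceI) simp

text \<open>Moving the location by at most \<open>e * b\<close> changes the density by a factor of
  at most exp e, pointwise. An arbitrary nonnegative \<open>h\<close> is allowed so that
  \<open>h\<close> can itself be an integral over further noise.\<close>

lemma laplace_shift_le:
  assumes b: "0 < b" and [measurable]: "h \<in> borel_measurable borel"
    and d: "\<bar>m - m'\<bar> \<le> e * b"
  shows "(\<integral>\<^sup>+ t. h (m + t) \<partial>laplace b) \<le> ennreal (exp e) * (\<integral>\<^sup>+ t. h (m' + t) \<partial>laplace b)"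
proof -
  have shift: "(\<integral>\<^sup>+ t. h (m + t) \<partial>laplace b) =
      (\<integral>\<^sup>+ y. ennreal (exp (- \<bar>y - m\<bar> / b) / (2 * b)) * h y \<partial>lborel)" for m
    unfolding laplace_def
    by (subst nn_integral_density, simp, simp,
        subst nn_integral_real_affine[where c = 1 and t = "- m"]) (simp_all add: algebra_simps)
  have "exp (- \<bar>y - m\<bar> / b) / (2 * b) \<le> exp e * (exp (- \<bar>y - m'\<bar> / b) / (2 * b))" for y
  proof -
    have "- \<bar>y - m\<bar> / b \<le> (e * b - \<bar>y - m'\<bar>) / b"
      using b d by (intro divide_right_mono) auto
    then have "- \<bar>y - m\<bar> / b \<le> e + - \<bar>y - m'\<bar> / b"
      using b by (simp add: diff_divide_distrib)
    then have "exp (- \<bar>y - m\<bar> / b) \<le> exp e * exp (- \<bar>y - m'\<bar> / b)"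
      by (simp add: exp_add[symmetric])
    then show ?thesis using b by (simp add: divide_right_mono)
  qed
  then have "(\<integral>\<^sup>+ y. ennreal (exp (- \<bar>y - m\<bar> / b) / (2 * b)) * h y \<partial>lborel) \<le>
      (\<integral>\<^sup>+ y. ennreal (exp e) * (ennreal (exp (- \<bar>y - m'\<bar> / b) / (2 * b)) * h y) \<partial>lborel)"
    using b by (intro nn_integral_mono) (simp add: mult.assoc[symmetric] ennreal_mult[symmetric] mult_right_mono ennreal_leI)
  also have "\<dots> = ennreal (exp e) * (\<integral>\<^sup>+ y. ennreal (exp (- \<bar>y - m'\<bar> / b) / (2 * b)) * h y \<partial>lborel)"
    by (rule nn_integral_cmult) measurable
  finally show ?thesis unfolding shift .
qed

text \<open>The restriction keeps the result in \<open>vec_space l\<close> although \<open>v\<close>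
  is an arbitrary function beyond \<open>l\<close>, as \<open>dev_sum\<close> is.\<close>

definition shift_vec :: "nat \<Rightarrow> rvec \<Rightarrow> rvec \<Rightarrow> rvec" where
  "shift_vec l v g = (\<lambda>k\<in>{..<l}. v k + g k)"

text \<open>The Cameron-Martin density exp ((2 <g, v> - |v|^2) / (2 s^2)), kept as a product over
  the coordinates.\<close>

definition shift_density :: "nat \<Rightarrow> real \<Rightarrow> rvec \<Rightarrow> rvec \<Rightarrow> real" where
  "shift_density l s v g = (\<Prod>k<l. exp ((2 * g k * v k - (v k)\<^sup>2) / (2 * s\<^sup>2)))"

lemma measurable_shift_vec [measurable]: "shift_vec l v \<in> vec_space l \<rightarrow>\<^sub>M vec_space l"
proof -
  have "(\<lambda>g. \<lambda>k\<in>{..<l}. v k + g k) \<in> vec_space l \<rightarrow>\<^sub>M Pi\<^sub>M {..<l} (\<lambda>_. borel)"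
    by (rule measurable_restrict) measurable
  then show ?thesis by (simp add: shift_vec_def [abs_def] vec_space_def)
qed

lemma measurable_shift_density [measurable]: "shift_density l s v \<in> borel_measurable (vec_space l)"
  unfolding shift_density_def [abs_def] by measurable

lemma gaussian_shift:
  assumes s: "0 < s" and B [measurable]: "B \<in> sets borel"
  shows "(\<integral>\<^sup>+ t. indicator B t * ennreal (exp ((2 * t * v - v\<^sup>2) / (2 * s\<^sup>2))) \<partial>gaussian 0 s) =
    (\<integral>\<^sup>+ t. indicator B (v + t) \<partial>gaussian 0 s)"
proof -
  have e: "normal_density 0 s (v + t) * exp ((2 * (v + t) * v - v\<^sup>2) / (2 * s\<^sup>2)) = normal_density 0 s t" for t
  proof -
    have "- (v + t - 0)\<^sup>2 / (2 * s\<^sup>2) + (2 * (v + t) * v - v\<^sup>2) / (2 * s\<^sup>2) = - (t - 0)\<^sup>2 / (2 * s\<^sup>2)"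
      unfolding add_divide_distrib[symmetric] by (simp add: power2_eq_square algebra_simps)
    then show ?thesis
      unfolding normal_density_def mult.assoc exp_add[symmetric] by simp
  qed
  have "(\<integral>\<^sup>+ t. indicator B t * ennreal (exp ((2 * t * v - v\<^sup>2) / (2 * s\<^sup>2))) \<partial>gaussian 0 s) =
      (\<integral>\<^sup>+ t. ennreal (normal_density 0 s t * exp ((2 * t * v - v\<^sup>2) / (2 * s\<^sup>2))) * indicator B t \<partial>lborel)"
    by (subst nn_integral_density) (auto simp: ennreal_mult mult_ac)
  also have "\<dots> = (\<integral>\<^sup>+ t. ennreal (normal_density 0 s (v + t) * exp ((2 * (v + t) * v - v\<^sup>2) / (2 * s\<^sup>2))) * indicator B (v + t) \<partial>lborel)"
    by (subst nn_integral_real_affine[where c = 1 and t = v]) auto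
  also have "\<dots> = (\<integral>\<^sup>+ t. indicator B (v + t) \<partial>gaussian 0 s)"
    unfolding e by (subst nn_integral_density) auto
  finally show ?thesis .
qed

text \<open>Both measures are identified with the product of the one-dimensional tilted measures
  \<open>?M k\<close>, which is determined by its values on boxes. On a box either side factors into
  coordinates, and \<open>gaussian_shift\<close> matches the factors.\<close>

lemma distr_shift_vec:
  fixes l :: nat
  assumes s: "0 < s"
  defines "N \<equiv> spherical_gaussian l (\<lambda>_. 0) s"
  shows "distr N (vec_space l) (shift_vec l v) = density N (shift_density l s v)"
proof -
  let ?\<rho> = "\<lambda>k t. exp ((2 * t * v k - (v k)\<^sup>2) / (2 * s\<^sup>2))"
  let ?M = "\<lambda>k. density (gaussian 0 s) (\<lambda>t. ennreal (?\<rho> k t))"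
  have em: "emeasure (?M k) A = (\<integral>\<^sup>+ t. indicator A (v k + t) \<partial>gaussian 0 s)" if "A \<in> sets borel" for k A
    using that by (subst emeasure_density) (auto simp: gaussian_shift[OF s, symmetric] mult.commute)
  \<comment> \<open>Seen through \<open>em\<close>, \<open>?M k\<close> is the law of a translated
    Gaussian variable, so its mass is 1.\<close>
  have "prob_space (?M k)" for k
  proof
    interpret prob_space "gaussian 0 s" by (rule prob_space_gaussian) fact
    show "emeasure (?M k) (space (?M k)) = 1"
      using em[of UNIV k] emeasure_space_1 by simp
  qed
  then interpret product_prob_space ?M by (rule product_prob_spaceI)
  have sets: "sets (Pi\<^sub>M {..<l} ?M) = sets (vec_space l)"
    unfolding vec_space_def by (rule sets_PiM_cong) auto
  have box: "Pi\<^sub>E {..<l} A \<in> sets (vec_space l)" if "\<And>k. k \<in> {..<l} \<Longrightarrow> A k \<in> sets (?M k)" for A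
    unfolding vec_space_def using that by (intro sets_PiM_I_finite) auto
  have ind: "indicator (Pi\<^sub>E {..<l} A) g = (\<Prod>k<l. indicator (A k) (g k) :: ennreal)"
    if "g \<in> space (vec_space l)" for A g
  proof -
    have "g \<in> Pi\<^sub>E {..<l} A \<longleftrightarrow> (\<forall>k<l. g k \<in> A k)"
      using that by (auto simp: space_vec_space PiE_iff)
    then show ?thesis
      by (auto simp: indicator_def prod_zero_iff)
  qed
  have "distr N (vec_space l) (shift_vec l v) = Pi\<^sub>M {..<l} ?M"
  proof (rule PiM_eqI)
    fix A assume A: "\<And>k. k \<in> {..<l} \<Longrightarrow> A k \<in> sets (?M k)"
    have [measurable]: "A k \<in> sets borel" if "k < l" for k
      using A[of k] that by simp
    have "emeasure (distr N (vec_space l) (shift_vec l v)) (Pi\<^sub>E {..<l} A) =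
        (\<integral>\<^sup>+ g. indicator (Pi\<^sub>E {..<l} A) g \<partial>distr N (vec_space l) (shift_vec l v))"
      using box[OF A] by simp
    also have "\<dots> = (\<integral>\<^sup>+ g. indicator (Pi\<^sub>E {..<l} A) (shift_vec l v g) \<partial>N)"
      using box[OF A] by (intro nn_integral_distr) (auto simp: N_def)
    also have "\<dots> = (\<integral>\<^sup>+ g. (\<Prod>k<l. indicator (A k) (v k + g k)) \<partial>N)"
      by (intro nn_integral_cong, subst ind)
         (auto simp: N_def shift_vec_def space_vec_space intro!: prod.cong)
    also have "\<dots> = (\<Prod>k<l. emeasure (?M k) (A k))"
      unfolding N_def
      by (subst nn_integral_spherical_gaussian_prod[OF s, where f = "\<lambda>k t. indicator (A k) (v k + t)"])
         (use A in \<open>auto simp: em intro!: prod.cong\<close>)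
    finally show "emeasure (distr N (vec_space l) (shift_vec l v)) (Pi\<^sub>E {..<l} A) =
        (\<Prod>k<l. emeasure (?M k) (A k))" .
  qed (simp_all add: sets)
  moreover have "density N (shift_density l s v) = Pi\<^sub>M {..<l} ?M"
  proof (rule PiM_eqI)
    fix A assume A: "\<And>k. k \<in> {..<l} \<Longrightarrow> A k \<in> sets (?M k)"
    have [measurable]: "A k \<in> sets borel" if "k < l" for k
      using A[of k] that by simp
    have "emeasure (density N (shift_density l s v)) (Pi\<^sub>E {..<l} A) =
        (\<integral>\<^sup>+ g. ennreal (shift_density l s v g) * indicator (Pi\<^sub>E {..<l} A) g \<partial>N)"
      using box[OF A] by (subst emeasure_density) (auto simp: N_def)
    also have "\<dots> = (\<integral>\<^sup>+ g. (\<Prod>k<l. ennreal (?\<rho> k (g k)) * indicator (A k) (g k)) \<partial>N)"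
      by (intro nn_integral_cong, subst ind)
         (auto simp: N_def shift_density_def prod.distrib prod_ennreal)
    also have "\<dots> = (\<Prod>k<l. emeasure (?M k) (A k))"
      unfolding N_def
      by (subst nn_integral_spherical_gaussian_prod[OF s, where f = "\<lambda>k t. ennreal (?\<rho> k t) * indicator (A k) t"])
         (use A in \<open>auto simp: emeasure_density intro!: prod.cong\<close>)
    finally show "emeasure (density N (shift_density l s v)) (Pi\<^sub>E {..<l} A) =
        (\<Prod>k<l. emeasure (?M k) (A k))" .
  qed (simp_all add: sets N_def)
  ultimately show ?thesis by simp
qed

section \<open>The Gaussian mechanism and sensitivity\<close>

text \<open>Let \<open>\<rho>\<close> be the density of the translated noise with respect to the original noise. As
  \<open>h \<le> 1\<close>, pointwise \<open>h \<le> exp e * \<rho> * h + (exp e * \<rho>) powr (- \<theta>)\<close>. The mean of the last term is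
  a Gaussian integral, which for \<open>\<theta> = 2 * ln (1 / d) / e\<close> and the given scale is at most \<open>d\<close>.\<close>

lemma gaussian_mechanism:
  fixes l :: nat and v v' :: rvec and h :: "rvec \<Rightarrow> ennreal"
  assumes e: "0 < e" and d: "0 < d" "d < 1" and D: "0 < D"
    and sdef: "s = D * sqrt (e + 2 * ln (1 / d)) / e"
    and h [measurable]: "h \<in> borel_measurable (vec_space l)" and h1: "\<And>y. h y \<le> 1"
    and sens: "(\<Sum>k<l. (v' k - v k)\<^sup>2) \<le> D\<^sup>2"
  defines "N \<equiv> spherical_gaussian l (\<lambda>_. 0) s"
  shows "(\<integral>\<^sup>+ g. h (shift_vec l v g) \<partial>N) \<le>
    ennreal (exp e) * (\<integral>\<^sup>+ g. h (shift_vec l v' g) \<partial>N) + ennreal d"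
proof -
  define L where "L = ln (1 / d)"
  have L: "0 < L" using d by (simp add: L_def)
  have s: "0 < s" "s\<^sup>2 = D\<^sup>2 * (e + 2 * L) / e\<^sup>2"
    using e L D by (auto simp: sdef L_def[symmetric] power_mult_distrib power_divide)
  define w where "w = (\<lambda>k. v' k - v k)"
  define R where "R = (\<lambda>g. \<Sum>k<l. (2 * g k * w k - (w k)\<^sup>2) / (2 * s\<^sup>2))"
  define \<theta> where "\<theta> = 2 * L / e"
  have \<theta>: "0 < \<theta>" using L e by (simp add: \<theta>_def)
  have R: "shift_density l s w g = exp (R g)" for g
    by (simp add: shift_density_def R_def exp_sum)
  have [measurable]: "R \<in> borel_measurable (vec_space l)"
    unfolding R_def by measurable
  \<comment> \<open>Translating by \<open>v'\<close> is translating by \<open>w\<close> first and by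
    \<open>v\<close> afterwards. Hence both integrals can be written with
    \<open>shift_vec l v\<close>, and only the difference \<open>w\<close> enters the
    density.\<close>
  have comp: "shift_vec l v' g = shift_vec l v (shift_vec l w g)" for g
    by (auto simp: shift_vec_def w_def)
  have sets_N [measurable_cong]: "sets N = sets (vec_space l)" by (simp add: N_def)
  have "(\<integral>\<^sup>+ g. h (shift_vec l v' g) \<partial>N) = (\<integral>\<^sup>+ y. h (shift_vec l v y) \<partial>distr N (vec_space l) (shift_vec l w))"
    unfolding comp by (rule nn_integral_distr[symmetric]) measurable
  also have "\<dots> = (\<integral>\<^sup>+ g. ennreal (exp (R g)) * h (shift_vec l v g) \<partial>N)"
    unfolding N_def distr_shift_vec[OF s(1)] R by (rule nn_integral_density) measurable
  finally have I': "(\<integral>\<^sup>+ g. h (shift_vec l v' g) \<partial>N) =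
      (\<integral>\<^sup>+ g. ennreal (exp (R g)) * h (shift_vec l v g) \<partial>N)" .
  have pointwise: "h (shift_vec l v g) \<le>
      ennreal (exp e) * (ennreal (exp (R g)) * h (shift_vec l v g)) + ennreal (exp (- \<theta> * (e + R g)))" for g
  proof (cases "0 \<le> e + R g")
    case True
    then have "1 \<le> ennreal (exp e) * ennreal (exp (R g))"
      by (simp add: ennreal_mult[symmetric] exp_add[symmetric])
    then have "1 * h (shift_vec l v g) \<le> ennreal (exp e) * ennreal (exp (R g)) * h (shift_vec l v g)"
      by (rule mult_right_mono) simp
    then show ?thesis by (simp add: mult.assoc add_increasing2)
  next
    case False
    then have "1 \<le> ennreal (exp (- \<theta> * (e + R g)))"
      using \<theta> by (simp add: mult_nonneg_nonpos)
    then show ?thesis using h1 by (meson add_increasing order_trans zero_le)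
  qed
  \<comment> \<open>This is the moment of order - \<theta> of the density. The constant part of the
    exponent contributes \<theta> and the linear part \<theta> squared, whence the factor
    \<open>\<theta> * (\<theta> + 1)\<close>.\<close>
  have one: "(\<integral>\<^sup>+ t. ennreal (exp (- \<theta> * ((2 * t * w k - (w k)\<^sup>2) / (2 * s\<^sup>2)))) \<partial>gaussian 0 s) =
      ennreal (exp (\<theta> * (\<theta> + 1) * ((w k)\<^sup>2 / (2 * s\<^sup>2))))" for k
  proof -
    have "(\<integral>\<^sup>+ t. ennreal (exp (- \<theta> * ((2 * t * w k - (w k)\<^sup>2) / (2 * s\<^sup>2)))) \<partial>gaussian 0 s) =
        (\<integral>\<^sup>+ t. ennreal (exp (\<theta> * ((w k)\<^sup>2 / (2 * s\<^sup>2)))) * ennreal (exp (- \<theta> * w k / s\<^sup>2 * (t - 0))) \<partial>gaussian 0 s)"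
      using s(1) by (intro nn_integral_cong)
        (simp add: ennreal_mult[symmetric] exp_add[symmetric] field_simps)
    also have "\<dots> = ennreal (exp (\<theta> * ((w k)\<^sup>2 / (2 * s\<^sup>2)))) * ennreal (exp ((- \<theta> * w k / s\<^sup>2)\<^sup>2 * s\<^sup>2 / 2))"
      by (subst nn_integral_cmult, simp, simp only: gaussian_exp_linear[OF s(1)])
    also have "\<dots> = ennreal (exp (\<theta> * ((w k)\<^sup>2 / (2 * s\<^sup>2)) + (- \<theta> * w k / s\<^sup>2)\<^sup>2 * s\<^sup>2 / 2))"
      by (simp add: ennreal_mult[symmetric] exp_add[symmetric])
    also have "\<theta> * ((w k)\<^sup>2 / (2 * s\<^sup>2)) + (- \<theta> * w k / s\<^sup>2)\<^sup>2 * s\<^sup>2 / 2 = \<theta> * (\<theta> + 1) * ((w k)\<^sup>2 / (2 * s\<^sup>2))"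
      using s(1) by (simp add: power2_eq_square field_simps)
    finally show ?thesis .
  qed
  have "(\<integral>\<^sup>+ g. ennreal (exp (- \<theta> * R g)) \<partial>N) =
      (\<integral>\<^sup>+ g. (\<Prod>k<l. ennreal (exp (- \<theta> * ((2 * g k * w k - (w k)\<^sup>2) / (2 * s\<^sup>2))))) \<partial>N)"
    unfolding R_def sum_distrib_left by (simp add: exp_sum prod_ennreal prod_nonneg)
  also have "\<dots> = (\<Prod>k<l. ennreal (exp (\<theta> * (\<theta> + 1) * ((w k)\<^sup>2 / (2 * s\<^sup>2)))))"
    unfolding N_def
    by (subst nn_integral_spherical_gaussian_prod[OF s(1),
          where f = "\<lambda>k t. ennreal (exp (- \<theta> * ((2 * t * w k - (w k)\<^sup>2) / (2 * s\<^sup>2))))"])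
       (simp_all only: one, auto)
  also have "\<dots> = ennreal (exp (\<theta> * (\<theta> + 1) * ((\<Sum>k<l. (w k)\<^sup>2) / (2 * s\<^sup>2))))"
    unfolding sum_divide_distrib sum_distrib_left by (simp add: exp_sum prod_ennreal prod_nonneg)
  \<comment> \<open>As \<open>exp L * d = 1\<close>, the bound is just \<open>exp L\<close>. It is
    written so that \<open>exp (- \<theta> * e)\<close>, which is exp (-2 L), cancels both
    exponentials and leaves \<open>d\<close>.\<close>
  also have "\<dots> \<le> ennreal (exp L * (exp L * d))"
  proof -
    have "\<theta> * (\<theta> + 1) * ((\<Sum>k<l. (w k)\<^sup>2) / (2 * s\<^sup>2)) \<le> \<theta> * (\<theta> + 1) * (D\<^sup>2 / (2 * s\<^sup>2))"
      using sens \<theta> by (intro mult_left_mono divide_right_mono) (auto simp: w_def)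
    also have "\<dots> = L"
    proof -
      define A where "A = e + 2 * L"
      have "\<theta> + 1 = A / e" using e by (simp add: \<theta>_def A_def field_simps)
      moreover have "0 < A" using e L by (simp add: A_def)
      ultimately show ?thesis
        using e D unfolding s(2) A_def[symmetric] \<open>\<theta> + 1 = A / e\<close>
        by (simp add: \<theta>_def field_simps power2_eq_square)
    qed
    finally have "exp (\<theta> * (\<theta> + 1) * ((\<Sum>k<l. (w k)\<^sup>2) / (2 * s\<^sup>2))) \<le> exp L"
      by (simp only: exp_le_cancel_iff)
    moreover have "exp L * d = 1" using d by (simp add: L_def)
    ultimately show ?thesis by (simp only: mult_1_right ennreal_leI)
  qed
  finally have "(\<integral>\<^sup>+ g. ennreal (exp (- \<theta> * R g)) \<partial>N) \<le> ennreal (exp L * (exp L * d))" .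
  then have "ennreal (exp (- \<theta> * e)) * (\<integral>\<^sup>+ g. ennreal (exp (- \<theta> * R g)) \<partial>N) \<le>
      ennreal (exp (- \<theta> * e)) * ennreal (exp L * (exp L * d))"
    by (rule mult_left_mono) simp
  also have "\<dots> = ennreal d"
  proof -
    have "exp (- \<theta> * e) * (exp L * (exp L * d)) = exp (- \<theta> * e + L + L) * d"
      by (simp only: exp_add mult.assoc)
    also have "- \<theta> * e + L + L = 0" using e by (simp add: \<theta>_def)
    finally show ?thesis using d by (simp add: ennreal_mult[symmetric])
  qed
  finally have tail: "(\<integral>\<^sup>+ g. ennreal (exp (- \<theta> * (e + R g))) \<partial>N) \<le> ennreal d"
    by (subst (asm) nn_integral_cmult[symmetric])
       (auto simp: ennreal_mult[symmetric] exp_add[symmetric] algebra_simps)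
  have "(\<integral>\<^sup>+ g. h (shift_vec l v g) \<partial>N) \<le>
      (\<integral>\<^sup>+ g. ennreal (exp e) * (ennreal (exp (R g)) * h (shift_vec l v g)) + ennreal (exp (- \<theta> * (e + R g))) \<partial>N)"
    by (intro nn_integral_mono pointwise)
  also have "\<dots> = ennreal (exp e) * (\<integral>\<^sup>+ g. h (shift_vec l v' g) \<partial>N) + (\<integral>\<^sup>+ g. ennreal (exp (- \<theta> * (e + R g))) \<partial>N)"
    unfolding I' by (subst nn_integral_add, measurable, subst nn_integral_cmult, measurable)
  also have "\<dots> \<le> ennreal (exp e) * (\<integral>\<^sup>+ g. h (shift_vec l v' g) \<partial>N) + ennreal d"
    by (intro add_left_mono tail)
  finally show ?thesis .
qed

section \<open>The clipped statistics and their sensitivity\<close>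

definition clipped_dev :: "nat \<Rightarrow> rvec \<Rightarrow> real \<Rightarrow> rvec \<Rightarrow> rvec" where
  "clipped_dev l c r x = (if x \<in> vec_ball l c r then (\<lambda>k. x k - c k) else (\<lambda>_. 0))"

definition dev_sum :: "nat \<Rightarrow> rvec \<Rightarrow> real \<Rightarrow> rvec list \<Rightarrow> rvec" where
  "dev_sum l c r X k = (\<Sum>x\<leftarrow>X. clipped_dev l c r x k)"

text \<open>The sum of squares minus the squared sum over the size is the squared distance to the
  mean of the clipped deviations. For the empty list the division by zero gives the value 0.\<close>

definition scatter :: "nat \<Rightarrow> rvec \<Rightarrow> real \<Rightarrow> rvec list \<Rightarrow> real" where
  "scatter l c r X =
     (\<Sum>k<l. (\<Sum>x\<leftarrow>X. (clipped_dev l c r x k)\<^sup>2) - (dev_sum l c r X k)\<^sup>2 / real (length X))"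

lemma norm_clipped_dev: "0 \<le> r \<Longrightarrow> L2_set (clipped_dev l c r x) {..<l} \<le> r"
  by (auto simp: clipped_dev_def vec_ball_def vec_dist_def L2_set_def power2_commute)

lemma norm_dev_sum:
  assumes r: "0 \<le> r"
  shows "L2_set (dev_sum l c r X) {..<l} \<le> real (length X) * r"
proof (induction X)
  case Nil
  show ?case by (simp add: dev_sum_def L2_set_def)
next
  case (Cons x X)
  have "dev_sum l c r (x # X) = (\<lambda>k. clipped_dev l c r x k + dev_sum l c r X k)"
    by (simp add: dev_sum_def fun_eq_iff)
  then have "L2_set (dev_sum l c r (x # X)) {..<l} \<le>
      L2_set (clipped_dev l c r x) {..<l} + L2_set (dev_sum l c r X) {..<l}"
    using L2_set_triangle_ineq by metis
  also have "\<dots> \<le> r + real (length X) * r"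
    by (intro add_mono norm_clipped_dev r Cons.IH)
  finally show ?case by (simp add: algebra_simps)
qed

lemma dev_sum_insert:
  "dev_sum l c r (us @ x # vs) k = dev_sum l c r (us @ vs) k + clipped_dev l c r x k"
  by (simp add: dev_sum_def)

lemma L2_set_diff_le:
  "L2_set (\<lambda>k. f k - g k) A \<le> L2_set f A + L2_set g A"
proof -
  have "L2_set (\<lambda>k. f k + - g k) A \<le> L2_set f A + L2_set (\<lambda>k. - g k) A"
    by (rule L2_set_triangle_ineq)
  then show ?thesis by (simp add: L2_set_def)
qed

lemma sum_squares_L2: "(\<Sum>k\<in>A. (f k)\<^sup>2) = (L2_set f A)\<^sup>2"
  by (simp add: L2_set_def sum_nonneg)

text \<open>The sign of the increment matters as much as its size: two insertions into the same list
  then differ by at most \<open>4 * r\<^sup>2\<close>, without a factor 2.\<close>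

lemma scatter_insert:
  assumes r: "0 \<le> r"
  shows "\<exists>q. 0 \<le> q \<and> q \<le> 4 * r\<^sup>2 \<and> scatter l c r (us @ x # vs) = scatter l c r (us @ vs) + q"
proof -
  define n where "n = real (length (us @ vs))"
  define V where "V = dev_sum l c r (us @ vs)"
  define u where "u = clipped_dev l c r x"
  \<comment> \<open>The increment n/(n+1) |u - V/n|^2 with the inner division cleared. For
    \<open>n = 0\<close> it is 0 by division by zero, which agrees with the scatter of a single
    point.\<close>
  define q where "q = (\<Sum>k<l. (n * u k - V k)\<^sup>2 / (n * (n + 1)))"
  have n: "0 \<le> n" by (simp add: n_def)
  have coord: "(u k)\<^sup>2 - (V k + u k)\<^sup>2 / (n + 1) + (V k)\<^sup>2 / n = (n * u k - V k)\<^sup>2 / (n * (n + 1))" for k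
  proof (cases "n = 0")
    case True
    then have "length (us @ vs) = 0" unfolding n_def by (simp only: of_nat_eq_0_iff)
    then have "us = []" "vs = []" by simp_all
    then show ?thesis using True by (simp add: V_def dev_sum_def)
  next
    case False
    then have "n \<noteq> 0" "n + 1 \<noteq> 0" using n by auto
    then show ?thesis by (simp add: divide_simps) (simp add: power2_eq_square algebra_simps)
  qed
  have "scatter l c r (us @ x # vs) - scatter l c r (us @ vs) =
      (\<Sum>k<l. (u k)\<^sup>2 - (V k + u k)\<^sup>2 / (n + 1) + (V k)\<^sup>2 / n)"
    unfolding scatter_def sum_subtractf[symmetric] dev_sum_insert V_def[symmetric] u_def[symmetric]
    by (intro sum.cong) (simp_all add: n_def u_def algebra_simps)
  also have "\<dots> = q" unfolding q_def coord ..
  finally have eq: "scatter l c r (us @ x # vs) = scatter l c r (us @ vs) + q" by simp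
  have "0 \<le> q" unfolding q_def using n by (intro sum_nonneg) auto
  moreover have "q \<le> 4 * r\<^sup>2"
  proof (cases "n = 0")
    case True
    then show ?thesis by (simp add: q_def)
  next
    case False
    then have n: "0 < n" using n by simp
    have "L2_set (\<lambda>k. n * u k - V k) {..<l} \<le> L2_set (\<lambda>k. n * u k) {..<l} + L2_set V {..<l}"
      by (rule L2_set_diff_le)
    also have "L2_set (\<lambda>k. n * u k) {..<l} = n * L2_set u {..<l}"
      using n by (simp add: L2_set_right_distrib)
    also have "n * L2_set u {..<l} + L2_set V {..<l} \<le> n * r + n * r"
      unfolding u_def V_def n_def
      by (intro add_mono mult_left_mono norm_clipped_dev norm_dev_sum r) simp
    finally have "(L2_set (\<lambda>k. n * u k - V k) {..<l})\<^sup>2 \<le> (2 * n * r)\<^sup>2"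
      by (intro power_mono) auto
    then have "(\<Sum>k<l. (n * u k - V k)\<^sup>2) \<le> 4 * n * n * r\<^sup>2"
      unfolding sum_squares_L2 by (simp add: power_mult_distrib power2_eq_square[of n] mult_ac)
    also have "\<dots> \<le> 4 * r\<^sup>2 * (n * (n + 1))"
      using n by (simp add: algebra_simps mult_nonneg_nonneg)
    finally have "(\<Sum>k<l. (n * u k - V k)\<^sup>2) / (n * (n + 1)) \<le> 4 * r\<^sup>2"
      using n by (subst pos_divide_le_eq) auto
    then show ?thesis by (simp add: q_def sum_divide_distrib)
  qed
  ultimately show ?thesis using eq by auto
qed

text \<open>Every case goes through the common list \<open>us @ vs\<close>. For the sum a
  replacement is a difference of two vectors of norm at most \<open>r\<close>; for the scatter it is
  a difference of two increments from the same interval.\<close>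

lemma statistics_sensitivity:
  assumes r: "0 \<le> r" and nb: "neighbouring X X'"
  shows "(\<Sum>k<l. (dev_sum l c r X' k - dev_sum l c r X k)\<^sup>2) \<le> (2 * r)\<^sup>2"
    and "\<bar>scatter l c r X - scatter l c r X'\<bar> \<le> 4 * r\<^sup>2"
    and "\<bar>real (length X) - real (length X')\<bar> \<le> 1"
proof -
  have one: "(\<Sum>k<l. (clipped_dev l c r x k)\<^sup>2) \<le> (2 * r)\<^sup>2" for x
    unfolding sum_squares_L2 using norm_clipped_dev[OF r, of l c x] r
    by (intro power_mono) auto
  have two: "(\<Sum>k<l. (clipped_dev l c r y k - clipped_dev l c r x k)\<^sup>2) \<le> (2 * r)\<^sup>2" for x y
    unfolding sum_squares_L2
    using L2_set_diff_le[of "clipped_dev l c r y" "clipped_dev l c r x" "{..<l}"]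
      norm_clipped_dev[OF r, of l c x] norm_clipped_dev[OF r, of l c y]
    by (intro power_mono) auto
  from nb consider us vs x y where "X = us @ x # vs" "X' = us @ y # vs"
    | us vs x where "X = us @ x # vs" "X' = us @ vs"
    | us vs x where "X = us @ vs" "X' = us @ x # vs"
    unfolding neighbouring_def by blast
  note cases = this
  show "(\<Sum>k<l. (dev_sum l c r X' k - dev_sum l c r X k)\<^sup>2) \<le> (2 * r)\<^sup>2"
    by (cases rule: cases) (simp_all add: dev_sum_insert one[simplified] two[simplified])
  show "\<bar>scatter l c r X - scatter l c r X'\<bar> \<le> 4 * r\<^sup>2"
  proof (cases rule: cases)
    case (1 us vs x y)
    then show ?thesis
      using scatter_insert[OF r, of l c us x vs] scatter_insert[OF r, of l c us y vs] by auto
  next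
    case (2 us vs x)
    then show ?thesis using scatter_insert[OF r, of l c us x vs] by auto
  next
    case (3 us vs x)
    then show ?thesis using scatter_insert[OF r, of l c us x vs] by auto
  qed
  show "\<bar>real (length X) - real (length X')\<bar> \<le> 1"
    by (cases rule: cases) auto
qed

section \<open>The algorithm and its privacy\<close>

text \<open>The scale required by \<open>gaussian_mechanism\<close> for sensitivity
  \<open>2 * r\<close>, with a quarter of \<open>eps\<close> and all of
  \<open>delta\<close>.\<close>

definition mean_noise_scale :: "real \<Rightarrow> real \<Rightarrow> real \<Rightarrow> real" where
  "mean_noise_scale r eps delta = 2 * r * sqrt (eps / 4 + 2 * ln (1 / delta)) / (eps / 4)"

text \<open>Of the remaining budget, the size (sensitivity 1) gets \<open>eps / 2\<close> and the
  scatter (sensitivity \<open>4 * r\<^sup>2\<close>) gets \<open>eps / 4\<close>.\<close>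

definition noise :: "nat \<Rightarrow> real \<Rightarrow> real \<Rightarrow> real \<Rightarrow> (rvec \<times> real \<times> real) measure" where
  "noise l r eps delta =
     spherical_gaussian l (\<lambda>_. 0) (mean_noise_scale r eps delta) \<Otimes>\<^sub>M
       (laplace (2 / eps) \<Otimes>\<^sub>M laplace (16 * r\<^sup>2 / eps))"

text \<open>Postprocessing of the three noisy statistics. The noise can make the quotient under the
  root negative, hence the maximum. Dividing by \<open>m\<close> instead of \<open>m - 1\<close>
  costs a bias that the accuracy proof absorbs.\<close>

definition estimate :: "nat \<Rightarrow> rvec \<Rightarrow> rvec \<Rightarrow> real \<Rightarrow> real \<Rightarrow> rvec \<times> real" where
  "estimate l c y m q = ((\<lambda>k\<in>{..<l}. c k + y k / m), sqrt (max 0 (q / (real l * m))))"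

definition perturbed_estimate :: "nat \<Rightarrow> rvec \<Rightarrow> real \<Rightarrow> rvec list \<Rightarrow> rvec \<times> real \<times> real \<Rightarrow> rvec \<times> real" where
  "perturbed_estimate l c r X w =
     estimate l c (shift_vec l (dev_sum l c r X) (fst w))
       (real (length X) + fst (snd w)) (scatter l c r X + snd (snd w))"

definition PSGE :: "nat \<Rightarrow> rvec \<Rightarrow> real \<Rightarrow> real \<Rightarrow> real \<Rightarrow> real \<Rightarrow> real \<Rightarrow> real \<Rightarrow>
    rvec list \<Rightarrow> (rvec \<times> real) measure" where
  "PSGE l c r alpha_mu alpha_sigma beta eps delta X =
     distr (noise l r eps delta) (output_space l) (perturbed_estimate l c r X)"

lemma sets_noise [simp, measurable_cong]:
  "sets (noise l r eps delta) = sets (vec_space l \<Otimes>\<^sub>M (borel \<Otimes>\<^sub>M borel))"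
  unfolding noise_def by (intro sets_pair_measure_cong) simp_all

lemma space_noise [simp]: "space (noise l r eps delta) = space (vec_space l) \<times> UNIV"
  using sets_eq_imp_space_eq[OF sets_noise[of l r eps delta]] by (simp add: space_pair_measure)

lemma mean_noise_scale_pos:
  assumes "0 < r" "0 < eps" "0 < delta" "delta < 1"
  shows "0 < mean_noise_scale r eps delta"
  using assms by (simp add: mean_noise_scale_def add_pos_pos)

lemma prob_space_noise:
  assumes "0 < r" "0 < eps" "0 < delta" "delta < 1"
  shows "prob_space (noise l r eps delta)"
  unfolding noise_def using assms
  by (intro prob_space_pair prob_space_spherical_gaussian prob_space_laplace mean_noise_scale_pos) auto

text \<open>The order of integration serves privacy: for an indicator, the two inner integrals form
  a function of the noisy sum with values in [0, 1], as \<open>gaussian_mechanism\<close> demands,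
  and the Laplace noises can be compared with the noisy sum held fixed.\<close>

lemma nn_integral_noise:
  assumes p: "0 < r" "0 < eps" "0 < delta" "delta < 1"
    and f: "f \<in> borel_measurable (vec_space l \<Otimes>\<^sub>M (borel \<Otimes>\<^sub>M borel))"
  shows "(\<integral>\<^sup>+ w. f w \<partial>noise l r eps delta) =
    (\<integral>\<^sup>+ g. \<integral>\<^sup>+ a. \<integral>\<^sup>+ b. f (g, a, b) \<partial>laplace (16 * r\<^sup>2 / eps) \<partial>laplace (2 / eps)
      \<partial>spherical_gaussian l (\<lambda>_. 0) (mean_noise_scale r eps delta))"
proof -
  let ?A = "laplace (2 / eps)" and ?B = "laplace (16 * r\<^sup>2 / eps)"
  interpret A: prob_space ?A by (rule prob_space_laplace) (use p in simp)
  interpret B: prob_space ?B by (rule prob_space_laplace) (use p in simp)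
  interpret AB: prob_space "?A \<Otimes>\<^sub>M ?B" by (intro prob_space_pair) unfold_locales
  note [measurable] = f
  have "(\<integral>\<^sup>+ w. f w \<partial>noise l r eps delta) =
      (\<integral>\<^sup>+ g. \<integral>\<^sup>+ z. f (g, z) \<partial>(?A \<Otimes>\<^sub>M ?B) \<partial>spherical_gaussian l (\<lambda>_. 0) (mean_noise_scale r eps delta))"
    unfolding noise_def by (rule AB.nn_integral_fst[symmetric]) measurable
  also have "\<dots> = (\<integral>\<^sup>+ g. \<integral>\<^sup>+ a. \<integral>\<^sup>+ b. f (g, a, b) \<partial>?B \<partial>?A
      \<partial>spherical_gaussian l (\<lambda>_. 0) (mean_noise_scale r eps delta))"
    by (intro nn_integral_cong B.nn_integral_fst[symmetric]) measurable
  finally show ?thesis .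
qed

lemma measurable_vec_restrict:
  assumes "\<And>k. k < l \<Longrightarrow> (\<lambda>w. f w k) \<in> borel_measurable M"
  shows "(\<lambda>w. \<lambda>k\<in>{..<l}. f w k) \<in> M \<rightarrow>\<^sub>M vec_space l"
  unfolding vec_space_def by (rule measurable_restrict) (use assms in auto)

lemma measurable_estimate [measurable (raw)]:
  assumes [measurable]: "y \<in> M \<rightarrow>\<^sub>M vec_space l" "m \<in> borel_measurable M" "q \<in> borel_measurable M"
  shows "(\<lambda>w. estimate l c (y w) (m w) (q w)) \<in> M \<rightarrow>\<^sub>M output_space l"
proof -
  have [measurable]: "(\<lambda>w. \<lambda>k\<in>{..<l}. c k + y w k / m w) \<in> M \<rightarrow>\<^sub>M vec_space l"
    by (rule measurable_vec_restrict) measurable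
  show ?thesis unfolding estimate_def by measurable
qed

lemma measurable_perturbed_estimate [measurable]:
  "perturbed_estimate l c r X \<in> vec_space l \<Otimes>\<^sub>M (borel \<Otimes>\<^sub>M borel) \<rightarrow>\<^sub>M output_space l"
  unfolding perturbed_estimate_def [abs_def] by measurable

lemma measurable_vec_ball [measurable]: "vec_ball l c r \<in> sets (vec_space l)"
  unfolding vec_ball_def vec_dist_def L2_set_def by measurable

lemma measurable_clipped_dev:
  assumes "k < l"
  shows "(\<lambda>x. clipped_dev l c r x k) \<in> borel_measurable (vec_space l)"
proof -
  have "(\<lambda>x. if x \<in> vec_ball l c r then x k - c k else 0) \<in> borel_measurable (vec_space l)"
    using assms by measurable
  then show ?thesis by (simp add: clipped_dev_def if_distrib[of "\<lambda>f. f k"])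
qed

lemma sum_list_upt: "(\<Sum>x\<leftarrow>map f [0..<n]. g x) = (\<Sum>i<n. g (f i))" for g :: "'a \<Rightarrow> real"
  by (simp add: interv_sum_list_conv_sum_set_nat atLeast0LessThan comp_def)

text \<open>The law of the noise does not depend on the data, so joint measurability of
  \<open>perturbed_estimate\<close> in data and noise yields a measurable kernel.\<close>

lemma randomized_algorithm_PSGE:
  assumes "valid_params l c r alpha_mu alpha_sigma beta eps delta"
  shows "randomized_algorithm (vec_space l) (output_space l)
    (PSGE l c r alpha_mu alpha_sigma beta eps delta)"
  unfolding randomized_algorithm_def
proof
  fix n :: nat
  let ?P = "Pi\<^sub>M {..<n} (\<lambda>_. vec_space l)"
  let ?W = "vec_space l \<Otimes>\<^sub>M (borel \<Otimes>\<^sub>M borel) :: (rvec \<times> real \<times> real) measure"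
  have [measurable]: "(\<lambda>x. clipped_dev l c r (x i) k) \<in> borel_measurable ?P" if "i < n" "k < l" for i k
    by (rule measurable_compose[OF _ measurable_clipped_dev[OF that(2)]])
       (rule measurable_component_singleton, use that in simp)
  have D [measurable]: "(\<lambda>x. dev_sum l c r (map x [0..<n]) k) \<in> borel_measurable ?P" if "k < l" for k
    unfolding dev_sum_def sum_list_upt using that by measurable
  have S: "(\<lambda>x. scatter l c r (map x [0..<n])) \<in> borel_measurable ?P"
    unfolding scatter_def sum_list_upt length_map length_upt by measurable
  have [measurable]: "(\<lambda>p. scatter l c r (map (fst p) [0..<n])) \<in> borel_measurable (?P \<Otimes>\<^sub>M ?W)"
    by (rule measurable_compose[OF measurable_fst S])
  have [measurable]: "(\<lambda>p. shift_vec l (dev_sum l c r (map (fst p) [0..<n])) (fst (snd p))) \<in> ?P \<Otimes>\<^sub>M ?W \<rightarrow>\<^sub>M vec_space l"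
    unfolding shift_vec_def
    by (rule measurable_vec_restrict) (intro borel_measurable_add measurable_compose[OF measurable_fst D], measurable)
  have "(\<lambda>p. perturbed_estimate l c r (map (fst p) [0..<n]) (snd p)) \<in> ?P \<Otimes>\<^sub>M ?W \<rightarrow>\<^sub>M output_space l"
    unfolding perturbed_estimate_def length_map length_upt by measurable
  moreover have "noise l r eps delta \<in> space (prob_algebra ?W)"
    using assms by (simp add: space_prob_algebra prob_space_noise valid_params_def)
  ultimately show "(\<lambda>x. PSGE l c r alpha_mu alpha_sigma beta eps delta (map x [0..<n])) \<in> ?P \<rightarrow>\<^sub>M prob_algebra (output_space l)"
    unfolding PSGE_def
    by (intro measurable_distr_prob_space2[where M = ?W] measurable_const) (simp_all add: split_beta')
qed

lemma emeasure_PSGE: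
  assumes p: "0 < r" "0 < eps" "0 < delta" "delta < 1"
    and Y [measurable]: "Y \<in> sets (output_space l)"
  shows "emeasure (PSGE l c r alpha_mu alpha_sigma beta eps delta X) Y =
    (\<integral>\<^sup>+ g. \<integral>\<^sup>+ a. \<integral>\<^sup>+ b. indicator Y (estimate l c (shift_vec l (dev_sum l c r X) g)
        (real (length X) + a) (scatter l c r X + b))
      \<partial>laplace (16 * r\<^sup>2 / eps) \<partial>laplace (2 / eps)
      \<partial>spherical_gaussian l (\<lambda>_. 0) (mean_noise_scale r eps delta))"
proof -
  have "emeasure (PSGE l c r alpha_mu alpha_sigma beta eps delta X) Y =
      (\<integral>\<^sup>+ z. indicator Y z \<partial>PSGE l c r alpha_mu alpha_sigma beta eps delta X)"
    using Y by (simp add: PSGE_def)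
  also have "\<dots> = (\<integral>\<^sup>+ w. indicator Y (perturbed_estimate l c r X w) \<partial>noise l r eps delta)"
    unfolding PSGE_def by (rule nn_integral_distr) measurable
  also have "\<dots> = (\<integral>\<^sup>+ g. \<integral>\<^sup>+ a. \<integral>\<^sup>+ b. indicator Y (perturbed_estimate l c r X (g, a, b))
      \<partial>laplace (16 * r\<^sup>2 / eps) \<partial>laplace (2 / eps)
      \<partial>spherical_gaussian l (\<lambda>_. 0) (mean_noise_scale r eps delta))"
    by (rule nn_integral_noise[OF p]) measurable
  finally show ?thesis by (simp add: perturbed_estimate_def)
qed

text \<open>Composition of the three mechanisms, replacing the statistics of \<open>X\<close> by
  those of \<open>X'\<close> one at a time. \<open>F X y\<close> is the probability of
  \<open>Y\<close> given that the noisy sum is \<open>y\<close>.\<close>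

lemma differentially_private_PSGE:
  assumes vp: "valid_params l c r alpha_mu alpha_sigma beta eps delta"
  shows "differentially_private (vec_space l) (output_space l) eps delta
    (PSGE l c r alpha_mu alpha_sigma beta eps delta)"
  unfolding differentially_private_def
proof (intro ballI impI)
  fix X X' :: "rvec list" and Y
  assume nb: "neighbouring X X'" and Y [measurable]: "Y \<in> sets (output_space l)"
  have p: "0 < r" "0 < eps" "0 < delta" "delta < 1"
    using vp by (auto simp: valid_params_def)
  let ?A = "laplace (2 / eps)" and ?B = "laplace (16 * r\<^sup>2 / eps)"
  let ?N = "spherical_gaussian l (\<lambda>_. 0) (mean_noise_scale r eps delta)"
  let ?M = "PSGE l c r alpha_mu alpha_sigma beta eps delta"
  interpret A: prob_space ?A by (rule prob_space_laplace) (use p in simp)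
  interpret B: prob_space ?B by (rule prob_space_laplace) (use p in simp)
  define F where "F = (\<lambda>X y. \<integral>\<^sup>+ a. \<integral>\<^sup>+ b. indicator Y (estimate l c y
    (real (length X) + a) (scatter l c r X + b)) \<partial>?B \<partial>?A :: ennreal)"
  have em: "emeasure (?M X) Y = (\<integral>\<^sup>+ g. F X (shift_vec l (dev_sum l c r X) g) \<partial>?N)" for X
    unfolding F_def by (rule emeasure_PSGE[OF p Y])
  have meas: "F X \<in> borel_measurable (vec_space l)" for X
    unfolding F_def by measurable
  have F1: "F X y \<le> 1" for X y
  proof -
    have "F X y \<le> (\<integral>\<^sup>+ a. \<integral>\<^sup>+ b. 1 \<partial>?B \<partial>?A)"
      unfolding F_def by (intro nn_integral_mono) (auto simp: indicator_def)
    also have "\<dots> = 1"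
      using A.emeasure_space_1 B.emeasure_space_1 by simp
    finally show ?thesis .
  qed
  note sens = statistics_sensitivity[OF less_imp_le[OF p(1)] nb]
  have F_le: "F X y \<le> ennreal (exp (3 * eps / 4)) * F X' y" if y: "y \<in> space (vec_space l)" for y
  proof -
    have "F X y \<le> (\<integral>\<^sup>+ a. ennreal (exp (eps / 4)) *
        (\<integral>\<^sup>+ b. indicator Y (estimate l c y (real (length X) + a) (scatter l c r X' + b)) \<partial>?B) \<partial>?A)"
      unfolding F_def
    proof (intro nn_integral_mono laplace_shift_le[where h = "\<lambda>t. indicator Y (estimate l c y _ t)"])
      show "\<bar>scatter l c r X - scatter l c r X'\<bar> \<le> eps / 4 * (16 * r\<^sup>2 / eps)"
        using sens(2)[of l c] p by simp
    qed (use p in simp, use y in measurable)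
    also have "\<dots> = ennreal (exp (eps / 4)) * (\<integral>\<^sup>+ a.
        (\<integral>\<^sup>+ b. indicator Y (estimate l c y (real (length X) + a) (scatter l c r X' + b)) \<partial>?B) \<partial>?A)"
      using y by (intro nn_integral_cmult) measurable
    also have "\<dots> \<le> ennreal (exp (eps / 4)) * (ennreal (exp (eps / 2)) * F X' y)"
      unfolding F_def
    proof (intro mult_left_mono laplace_shift_le[where
        h = "\<lambda>t. \<integral>\<^sup>+ b. indicator Y (estimate l c y t (scatter l c r X' + b)) \<partial>?B"])
      show "\<bar>real (length X) - real (length X')\<bar> \<le> eps / 2 * (2 / eps)"
        using sens(3) p by simp
      show "0 < 2 / eps" using p by simp
      show "(\<lambda>t. \<integral>\<^sup>+ b. indicator Y (estimate l c y t (scatter l c r X' + b)) \<partial>?B) \<in> borel_measurable borel"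
        using y by measurable
    qed simp
    also have "\<dots> = ennreal (exp (3 * eps / 4)) * F X' y"
      by (simp add: mult.assoc[symmetric] ennreal_mult[symmetric] exp_add[symmetric])
    finally show ?thesis .
  qed
  \<comment> \<open>The sum is exchanged before the Laplace comparison is applied under the
    integral. In this order \<open>delta\<close> stays outside and is not multiplied by
    \<open>exp (3 * eps / 4)\<close>.\<close>
  have "emeasure (?M X) Y \<le>
      ennreal (exp (eps / 4)) * (\<integral>\<^sup>+ g. F X (shift_vec l (dev_sum l c r X') g) \<partial>?N) + ennreal delta"
    unfolding em
    by (rule gaussian_mechanism[where D = "2 * r"])
       (use p sens(1) meas F1 in \<open>simp_all add: mean_noise_scale_def\<close>)
  also have "\<dots> \<le> ennreal (exp (eps / 4)) * (\<integral>\<^sup>+ g. ennreal (exp (3 * eps / 4)) *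
      F X' (shift_vec l (dev_sum l c r X') g) \<partial>?N) + ennreal delta"
    by (intro add_right_mono mult_left_mono nn_integral_mono F_le)
       (auto intro: measurable_space[OF measurable_shift_vec])
  also have "\<dots> = ennreal (exp (eps / 4)) * (ennreal (exp (3 * eps / 4)) * emeasure (?M X') Y) + ennreal delta"
    unfolding em by (subst nn_integral_cmult) (auto intro!: measurable_compose[OF _ meas])
  also have "\<dots> = ennreal (exp eps) * emeasure (?M X') Y + ennreal delta"
    by (simp add: mult.assoc[symmetric] ennreal_mult[symmetric] exp_add[symmetric])
  finally have le: "emeasure (?M X) Y \<le> ennreal (exp eps) * emeasure (?M X') Y + ennreal delta" .
  have "finite_measure (?M X)" for X
    unfolding PSGE_def
    by (intro prob_space.finite_measure prob_space.prob_space_distr prob_space_noise p) measurable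
  then have "emeasure (?M X) Y = ennreal (measure (?M X) Y)" for X
    by (simp add: finite_measure.emeasure_eq_measure)
  with le have "ennreal (measure (?M X) Y) \<le> ennreal (exp eps * measure (?M X') Y + delta)"
    using p by (simp add: ennreal_mult ennreal_plus)
  then show "measure (?M X) Y \<le> exp eps * measure (?M X') Y + delta"
    using p by (subst (asm) ennreal_le_iff) auto
qed

section \<open>Accuracy\<close>

lemma dev_sum_in_ball:
  assumes "\<And>i. i < n \<Longrightarrow> x i \<in> vec_ball l c r"
  shows "dev_sum l c r (map x [0..<n]) k = sum_dev n mu x k + real n * (mu k - c k)"
proof -
  have "dev_sum l c r (map x [0..<n]) k = (\<Sum>i<n. (x i k - mu k) + (mu k - c k))"
    unfolding dev_sum_def sum_list_upt using assms by (intro sum.cong) (auto simp: clipped_dev_def)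
  then show ?thesis unfolding sum_dev_def sum.distrib by simp
qed

text \<open>Without clipping the scatter does not depend on the reference point: passing from
  \<open>c\<close> to \<open>mu\<close> adds \<open>2 * d * W + n * d\<^sup>2\<close> to the sum of
  squares and the same amount to the subtracted square.\<close>

lemma scatter_in_ball:
  assumes ball: "\<And>i. i < n \<Longrightarrow> x i \<in> vec_ball l c r" and n: "0 < n"
  shows "scatter l c r (map x [0..<n]) = sq_dev n l mu x - (\<Sum>k<l. (sum_dev n mu x k)\<^sup>2) / real n"
proof -
  have coord: "(\<Sum>y\<leftarrow>map x [0..<n]. (clipped_dev l c r y k)\<^sup>2) - (dev_sum l c r (map x [0..<n]) k)\<^sup>2 / real n =
      (\<Sum>i<n. (x i k - mu k)\<^sup>2) - (sum_dev n mu x k)\<^sup>2 / real n" for k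
  proof -
    define d where "d = mu k - c k"
    define W where "W = sum_dev n mu x k"
    have "(\<Sum>y\<leftarrow>map x [0..<n]. (clipped_dev l c r y k)\<^sup>2) = (\<Sum>i<n. (x i k - mu k)\<^sup>2 + (2 * d * (x i k - mu k) + d\<^sup>2))"
      unfolding sum_list_upt d_def using ball
      by (intro sum.cong) (auto simp: clipped_dev_def power2_eq_square algebra_simps)
    also have "\<dots> = (\<Sum>i<n. (x i k - mu k)\<^sup>2) + (2 * d * W + real n * d\<^sup>2)"
      unfolding sum.distrib sum_distrib_left[symmetric] W_def sum_dev_def by simp
    finally have squares: "(\<Sum>y\<leftarrow>map x [0..<n]. (clipped_dev l c r y k)\<^sup>2) =
        (\<Sum>i<n. (x i k - mu k)\<^sup>2) + (2 * d * W + real n * d\<^sup>2)" .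
    have expand: "(W + real n * d)\<^sup>2 / real n = W\<^sup>2 / real n + (2 * d * W + real n * d\<^sup>2)"
      using n by (simp add: power2_eq_square field_simps)
    have "dev_sum l c r (map x [0..<n]) k = W + real n * d"
      unfolding W_def d_def by (rule dev_sum_in_ball[OF ball])
    then show ?thesis unfolding W_def[symmetric] squares by (simp add: expand)
  qed
  have "scatter l c r (map x [0..<n]) =
      (\<Sum>k<l. (\<Sum>i<n. (x i k - mu k)\<^sup>2) - (sum_dev n mu x k)\<^sup>2 / real n)"
    unfolding scatter_def length_map length_upt using coord by simp
  also have "\<dots> = sq_dev n l mu x - (\<Sum>k<l. (sum_dev n mu x k)\<^sup>2) / real n"
    unfolding sum_subtractf sq_dev_def sum_divide_distrib by (subst sum.swap) simp
  finally show ?thesis .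
qed

text \<open>The error is W/n + (1/m - 1/n) V + g/m, with noisy count \<open>m\<close> and clipped
  sum \<open>V\<close>, and each summand gets a third of \<open>alpha * sd\<close>. Clipping gives
  |V| at most n r, so the second is at most r |a| / m; \<open>T \<le> n / 2\<close> keeps
  \<open>m\<close> above n/2.\<close>

lemma mean_accuracy:
  fixes l n :: nat
  assumes ball: "\<And>i. i < n \<Longrightarrow> x i \<in> vec_ball l c r"
    and pos: "0 < n" "0 < r" "0 < sd" "0 < alpha" "0 \<le> s"
    and a: "\<bar>a\<bar> \<le> T" "T \<le> real n / 2" "6 * r * T \<le> alpha * sd * real n"
    and g: "(\<Sum>k<l. (g k)\<^sup>2) \<le> 4 * real l * s\<^sup>2" "12 * s * sqrt (real l) \<le> alpha * sd * real n"
    and w: "(\<Sum>k<l. (sum_dev n mu x k)\<^sup>2) \<le> 4 * real l * (real n * sd\<^sup>2)" "36 * real l \<le> alpha\<^sup>2 * real n"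
  shows "vec_dist l mu (fst (perturbed_estimate l c r (map x [0..<n]) (g, a, b))) \<le> alpha * sd"
proof -
  define m where "m = real n + a"
  define V where "V = dev_sum l c r (map x [0..<n])"
  define W where "W = sum_dev n mu x"
  have m: "real n / 2 \<le> m" "0 < m" using a pos(1) by (auto simp: m_def)
  have nz: "real n \<noteq> 0" using pos by simp
  have V: "V k = W k + real n * (mu k - c k)" for k
    unfolding V_def W_def by (rule dev_sum_in_ball[OF ball])
  have coord: "c k + (V k + g k) / m - mu k = (1 / real n) * W k + ((1 / m - 1 / real n) * V k + (1 / m) * g k)" for k
  proof -
    have "c k - mu k = (W k - V k) / real n" unfolding V using nz by (simp add: field_simps)
    then have "c k = mu k + (W k - V k) / real n" by simp
    then show ?thesis by (simp add: diff_divide_distrib add_divide_distrib left_diff_distrib)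
  qed
  have L2_scale: "L2_set (\<lambda>k. t * f k) {..<l} = \<bar>t\<bar> * L2_set f {..<l}" for t f
  proof -
    have "L2_set (\<lambda>k. t * f k) {..<l} = L2_set (\<lambda>k. \<bar>t\<bar> * f k) {..<l}"
      by (simp add: L2_set_def power_mult_distrib)
    then show ?thesis by (simp add: L2_set_right_distrib)
  qed
  have "vec_dist l mu (fst (perturbed_estimate l c r (map x [0..<n]) (g, a, b))) =
      L2_set (\<lambda>k. c k + (V k + g k) / m - mu k) {..<l}"
    unfolding vec_dist_def perturbed_estimate_def estimate_def L2_set_def
    by (intro arg_cong[where f = sqrt] sum.cong)
       (auto simp: V_def m_def shift_vec_def power2_commute)
  also have "\<dots> = L2_set (\<lambda>k. (1 / real n) * W k + ((1 / m - 1 / real n) * V k + (1 / m) * g k)) {..<l}"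
    unfolding coord ..
  also have "\<dots> \<le> L2_set (\<lambda>k. (1 / real n) * W k) {..<l} +
      L2_set (\<lambda>k. (1 / m - 1 / real n) * V k + (1 / m) * g k) {..<l}"
    by (rule L2_set_triangle_ineq)
  also have "L2_set (\<lambda>k. (1 / m - 1 / real n) * V k + (1 / m) * g k) {..<l} \<le>
      L2_set (\<lambda>k. (1 / m - 1 / real n) * V k) {..<l} + L2_set (\<lambda>k. (1 / m) * g k) {..<l}"
    by (rule L2_set_triangle_ineq)
  also have "L2_set (\<lambda>k. (1 / real n) * W k) {..<l} \<le> alpha * sd / 3"
  proof -
    have "L2_set W {..<l} \<le> sqrt ((2 * sqrt (real l) * sqrt (real n) * sd)\<^sup>2)"
      unfolding L2_set_def using w(1) by (intro real_sqrt_le_mono) (simp add: W_def power_mult_distrib)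
    also have "\<dots> = 2 * sqrt (real l) * sqrt (real n) * sd" using pos by simp
    also have "\<dots> = (6 * sqrt (real l)) * (sqrt (real n) * sd) / 3" by simp
    also have "6 * sqrt (real l) = sqrt (36 * real l)" by (simp add: real_sqrt_mult)
    also have "sqrt (36 * real l) \<le> sqrt (alpha\<^sup>2 * real n)" using w(2) by (rule real_sqrt_le_mono)
    also have "sqrt (alpha\<^sup>2 * real n) = alpha * sqrt (real n)" using pos by (simp add: real_sqrt_mult)
    finally have "L2_set W {..<l} \<le> alpha * sqrt (real n) * (sqrt (real n) * sd) / 3"
      using pos by (simp add: mult_right_mono)
    also have "\<dots> = alpha * sd * (sqrt (real n) * sqrt (real n)) / 3" by (simp only: mult_ac)
    also have "\<dots> = alpha * sd / 3 * real n" by simp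
    finally show ?thesis
      using pos unfolding L2_scale by (simp add: field_simps)
  qed
  also have "L2_set (\<lambda>k. (1 / m - 1 / real n) * V k) {..<l} \<le> alpha * sd / 3"
  proof -
    have "\<bar>1 / m - 1 / real n\<bar> = \<bar>a\<bar> / (m * real n)"
      using m nz by (simp add: diff_divide_eq_iff m_def[symmetric] divide_simps abs_mult) (simp add: m_def)
    then have "L2_set (\<lambda>k. (1 / m - 1 / real n) * V k) {..<l} = \<bar>a\<bar> / (m * real n) * L2_set V {..<l}"
      unfolding L2_scale by simp
    also have "\<dots> \<le> \<bar>a\<bar> / (m * real n) * (real n * r)"
      using norm_dev_sum[of r l c "map x [0..<n]"] pos m by (intro mult_left_mono) (auto simp: V_def)
    also have "\<dots> = r * \<bar>a\<bar> / m" using nz by simp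
    also have "\<dots> \<le> r * T / m" using a pos m by (intro divide_right_mono mult_left_mono) auto
    also have "\<dots> \<le> alpha * sd / 3"
    proof -
      have "r * T * 3 \<le> alpha * sd * (real n / 2)" using a(3) by simp
      also have "\<dots> \<le> alpha * sd * m" using m pos by (intro mult_left_mono) auto
      finally show ?thesis using m by (simp add: field_simps)
    qed
    finally show ?thesis .
  qed
  also have "L2_set (\<lambda>k. (1 / m) * g k) {..<l} \<le> alpha * sd / 3"
  proof -
    have "L2_set g {..<l} \<le> sqrt ((2 * sqrt (real l) * s)\<^sup>2)"
      unfolding L2_set_def using g(1) by (intro real_sqrt_le_mono) (simp add: power_mult_distrib)
    also have "\<dots> = 2 * sqrt (real l) * s" using pos by simp
    finally have "6 * L2_set g {..<l} \<le> 12 * s * sqrt (real l)" by (simp add: mult_ac)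
    also note g(2)
    finally have "3 * L2_set g {..<l} \<le> alpha * sd * (real n / 2)" by simp
    also have "\<dots> \<le> alpha * sd * m" using m pos by (intro mult_left_mono) auto
    finally show ?thesis using m unfolding L2_scale by (simp add: field_simps)
  qed
  finally show ?thesis by simp
qed

text \<open>The noisy scatter is compared with \<open>m * K\<close> rather than
  \<open>n * K\<close>, which turns the error of the count into one more additive term. The total is
  at most half of \<open>alpha * n * K\<close>, hence at most \<open>alpha * m * K\<close>.\<close>

lemma variance_accuracy:
  fixes l n :: nat and g :: rvec
  assumes ball: "\<And>i. i < n \<Longrightarrow> x i \<in> vec_ball l c r"
    and pos: "0 < n" "0 < l" "0 < sd" "0 < alpha"
    and a: "\<bar>a\<bar> \<le> T" "T \<le> real n / 2" "6 * T \<le> alpha * real n"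
    and b: "\<bar>b\<bar> \<le> U" "6 * U \<le> alpha * (real l * real n * sd\<^sup>2)"
    and w: "(\<Sum>k<l. (sum_dev n mu x k)\<^sup>2) \<le> 4 * real l * (real n * sd\<^sup>2)" "48 \<le> alpha * real n"
    and q: "sq_dev n l mu x / sd\<^sup>2 \<le> real (n * l) * (1 + alpha / 6)"
      "real (n * l) * (1 - alpha / 12) \<le> sq_dev n l mu x / sd\<^sup>2"
  defines "v \<equiv> (snd (perturbed_estimate l c r (map x [0..<n]) (g, a, b)))\<^sup>2 / sd\<^sup>2"
  shows "1 - alpha \<le> v" "v \<le> 1 + alpha"
proof -
  define m where "m = real n + a"
  define K where "K = real l * sd\<^sup>2"
  define S where "S = scatter l c r (map x [0..<n])"
  have m: "real n / 2 \<le> m" "0 < m" using a pos(1) by (auto simp: m_def)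
  have K: "0 < K" using pos by (simp add: K_def)
  have sd2: "0 < sd\<^sup>2" using pos by simp
  have W: "0 \<le> (\<Sum>k<l. (sum_dev n mu x k)\<^sup>2) / real n" "(\<Sum>k<l. (sum_dev n mu x k)\<^sup>2) / real n \<le> 4 * K"
    using w(1) pos by (auto simp: sum_nonneg K_def field_simps)
  have W2: "48 * K \<le> alpha * real n * K" using w(2) K by (intro mult_right_mono) auto
  have Q: "sq_dev n l mu x \<le> real n * K * (1 + alpha / 6)" "real n * K * (1 - alpha / 12) \<le> sq_dev n l mu x"
    using q sd2 unfolding K_def by (simp_all add: field_simps)
  have "K * (6 * \<bar>a\<bar>) \<le> K * (alpha * real n)"
    using a K by (intro mult_left_mono) auto
  then have A: "\<bar>a * K\<bar> \<le> alpha * real n * K / 6"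
    using K by (simp add: abs_mult mult_ac)
  have B: "\<bar>b\<bar> \<le> alpha * real n * K / 6" using b by (simp add: K_def mult_ac)
  have S: "S = sq_dev n l mu x - (\<Sum>k<l. (sum_dev n mu x k)\<^sup>2) / real n"
    unfolding S_def by (rule scatter_in_ball[OF ball pos(1)])
  have Q': "sq_dev n l mu x \<le> real n * K + alpha * real n * K / 6"
    "real n * K - alpha * real n * K / 12 \<le> sq_dev n l mu x"
    using Q by (simp_all add: algebra_simps)
  have "m * K = real n * K + a * K" by (simp add: m_def algebra_simps)
  \<comment> \<open>In units of \<open>alpha * n * K\<close>, the count and the Laplace noise cost
    1/6 each. From above the chi-square error adds 1/6. From below it adds 1/12, and the subtracted
    square of the sum another 1/12, because \<open>4 * K\<close> is at most that by
    \<open>48 \<le> alpha * n\<close>.\<close>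
  then have "\<bar>S + b - m * K\<bar> \<le> alpha * real n * K / 2"
    using W W2 Q' A B unfolding S by linarith
  also have "\<dots> = alpha * K * (real n / 2)" by simp
  also have "\<dots> \<le> alpha * K * m" using m K pos by (intro mult_left_mono) auto
  finally have close: "m * K * (1 - alpha) \<le> S + b" "S + b \<le> m * K * (1 + alpha)"
    by (simp_all add: abs_le_iff algebra_simps)
  have v: "v = max 0 ((S + b) / (real l * m)) / sd\<^sup>2"
    by (simp add: v_def perturbed_estimate_def estimate_def S_def m_def)
  have "(1 - alpha) * sd\<^sup>2 \<le> (S + b) / (real l * m)"
    using close(1) m pos by (simp add: field_simps K_def)
  then have "(1 - alpha) * sd\<^sup>2 \<le> max 0 ((S + b) / (real l * m))" by simp
  then show "1 - alpha \<le> v"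
    unfolding v using sd2 by (simp add: le_divide_eq)
  have "(S + b) / (real l * m) \<le> (1 + alpha) * sd\<^sup>2"
    using close(2) m pos by (simp add: field_simps K_def)
  then have "max 0 ((S + b) / (real l * m)) \<le> (1 + alpha) * sd\<^sup>2" using pos by simp
  then show "v \<le> 1 + alpha"
    unfolding v using sd2 by (simp add: divide_le_eq)
qed

section \<open>Failure probabilities of noise and sample\<close>

lemma emeasure_Un3_le:
  assumes "A \<in> sets M" "B \<in> sets M" "C \<in> sets M"
    and "emeasure M A \<le> ennreal t" "emeasure M B \<le> ennreal t" "emeasure M C \<le> ennreal t" and "0 \<le> t"
  shows "emeasure M (A \<union> B \<union> C) \<le> ennreal (3 * t)"
proof -
  have "emeasure M (A \<union> B \<union> C) \<le> emeasure M A + emeasure M B + emeasure M C"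
    using emeasure_subadditive[of "A \<union> B" M C] emeasure_subadditive[of A M B] assms(1-3)
    by (meson add_mono order_refl order_trans sets.Un)
  also have "\<dots> \<le> ennreal t + ennreal t + ennreal t"
    using assms by (intro add_mono) auto
  also have "\<dots> = ennreal (3 * t)"
    using assms(7) by (simp add: ennreal_plus[symmetric] del: ennreal_plus)
  finally show ?thesis .
qed

text \<open>The Laplace thresholds are \<open>y\<close> times the scales, so each is exceeded with
  probability exp (-y); for the norm, exp (-l/2) is at most exp (-y).\<close>

lemma noise_tail:
  fixes l :: nat and eps r delta y :: real
  assumes p: "0 < r" "0 < eps" "0 < delta" "delta < 1" and y: "0 \<le> y" "2 * y \<le> real l"
  defines "s \<equiv> mean_noise_scale r eps delta"
  shows "emeasure (noise l r eps delta)
    ({g \<in> space (vec_space l). 4 * real l * s\<^sup>2 \<le> (\<Sum>k<l. (g k)\<^sup>2)} \<times> UNIV \<union>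
     space (vec_space l) \<times> ({t. 2 / eps * y \<le> \<bar>t\<bar>} \<times> UNIV) \<union>
     space (vec_space l) \<times> (UNIV \<times> {t. 16 * r\<^sup>2 / eps * y \<le> \<bar>t\<bar>})) \<le> ennreal (3 * exp (- y))"
proof (rule emeasure_Un3_le)
  let ?A = "laplace (2 / eps)" and ?B = "laplace (16 * r\<^sup>2 / eps)"
  let ?N = "spherical_gaussian l (\<lambda>_. 0) s"
  have s: "0 < s" unfolding s_def by (rule mean_noise_scale_pos) fact+
  interpret N: prob_space ?N by (rule prob_space_spherical_gaussian) fact
  interpret A: prob_space ?A by (rule prob_space_laplace) (use p in simp)
  interpret B: prob_space ?B by (rule prob_space_laplace) (use p in simp)
  interpret AB: prob_space "?A \<Otimes>\<^sub>M ?B" by (intro prob_space_pair) unfold_locales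
  have UNIV_AB: "emeasure (?A \<Otimes>\<^sub>M ?B) UNIV = 1"
    using AB.emeasure_space_1 by (simp add: space_pair_measure)
  have UNIV_A: "emeasure ?A UNIV = 1" and UNIV_B: "emeasure ?B UNIV = 1"
    using A.emeasure_space_1 B.emeasure_space_1 by simp_all
  have space_N: "emeasure ?N (space (vec_space l)) = 1" using N.emeasure_space_1 by simp
  have G: "{g \<in> space (vec_space l). 4 * real l * s\<^sup>2 \<le> (\<Sum>k<l. (g k)\<^sup>2)} \<in> sets (vec_space l)"
    by measurable
  have tA: "{t :: real. 2 / eps * y \<le> \<bar>t\<bar>} \<in> sets borel" and tB: "{t :: real. 16 * r\<^sup>2 / eps * y \<le> \<bar>t\<bar>} \<in> sets borel"
    by measurable
  have UNIV2: "(UNIV :: (real \<times> real) set) \<in> sets (borel \<Otimes>\<^sub>M borel)"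
    using sets.top[of "borel \<Otimes>\<^sub>M borel :: (real \<times> real) measure"] by (simp add: space_pair_measure)
  show "{g \<in> space (vec_space l). 4 * real l * s\<^sup>2 \<le> (\<Sum>k<l. (g k)\<^sup>2)} \<times> UNIV \<in> sets (noise l r eps delta)"
    unfolding sets_noise by (intro pair_measureI G UNIV2)
  show "space (vec_space l) \<times> ({t. 2 / eps * y \<le> \<bar>t\<bar>} \<times> UNIV) \<in> sets (noise l r eps delta)"
    unfolding sets_noise by (intro pair_measureI tA sets.top) simp
  show "space (vec_space l) \<times> (UNIV \<times> {t. 16 * r\<^sup>2 / eps * y \<le> \<bar>t\<bar>}) \<in> sets (noise l r eps delta)"
    unfolding sets_noise by (intro pair_measureI tB sets.top) simp
  have "emeasure (noise l r eps delta) ({g \<in> space (vec_space l). 4 * real l * s\<^sup>2 \<le> (\<Sum>k<l. (g k)\<^sup>2)} \<times> UNIV) =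
      emeasure ?N {g \<in> space ?N. 4 * real l * s\<^sup>2 \<le> (\<Sum>k<l. (g k)\<^sup>2)}"
    unfolding noise_def s_def[symmetric]
    using G UNIV2 by (subst AB.emeasure_pair_measure_Times) (auto simp: UNIV_AB cong: sets_pair_measure_cong)
  also have "\<dots> \<le> ennreal (exp (- (real l / 2)))"
    by (rule spherical_gaussian_norm_tail) fact
  also have "\<dots> \<le> ennreal (exp (- y))" using y by (intro ennreal_leI) simp
  finally show "emeasure (noise l r eps delta) ({g \<in> space (vec_space l). 4 * real l * s\<^sup>2 \<le> (\<Sum>k<l. (g k)\<^sup>2)} \<times> UNIV) \<le> ennreal (exp (- y))" .
  have "emeasure (noise l r eps delta) (space (vec_space l) \<times> ({t. 2 / eps * y \<le> \<bar>t\<bar>} \<times> UNIV)) =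
      emeasure ?A {t. 2 / eps * y \<le> \<bar>t\<bar>}"
    unfolding noise_def s_def[symmetric]
    using tA by (subst AB.emeasure_pair_measure_Times, simp, simp, subst B.emeasure_pair_measure_Times)
      (simp_all add: UNIV_B space_N)
  also have "\<dots> = ennreal (exp (- y))"
    using p y by (subst laplace_tail) auto
  finally show "emeasure (noise l r eps delta) (space (vec_space l) \<times> ({t. 2 / eps * y \<le> \<bar>t\<bar>} \<times> UNIV)) \<le> ennreal (exp (- y))"
    by simp
  have "emeasure (noise l r eps delta) (space (vec_space l) \<times> (UNIV \<times> {t. 16 * r\<^sup>2 / eps * y \<le> \<bar>t\<bar>})) =
      emeasure ?B {t. 16 * r\<^sup>2 / eps * y \<le> \<bar>t\<bar>}"
    unfolding noise_def s_def[symmetric]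
    using tB by (subst AB.emeasure_pair_measure_Times, simp, simp, subst B.emeasure_pair_measure_Times)
      (simp_all add: UNIV_A space_N)
  also have "\<dots> = ennreal (exp (- y))"
    using p y by (subst laplace_tail) auto
  finally show "emeasure (noise l r eps delta) (space (vec_space l) \<times> (UNIV \<times> {t. 16 * r\<^sup>2 / eps * y \<le> \<bar>t\<bar>})) \<le> ennreal (exp (- y))"
    by simp
qed simp

text \<open>The lower tail bound applies to relative deviations up to 1, whence the guard
  \<open>alpha \<le> 12\<close>. For larger \<open>alpha\<close> the lower bound on
  \<open>sq_dev\<close> is nonpositive and holds for every sample.\<close>

lemma sample_tail:
  fixes l n :: nat and mu :: rvec
  assumes p: "0 < n" "0 < sd" "0 < alpha" and y: "2 * y \<le> real l"
    and u: "y \<le> min (alpha / 6) 1 * (alpha / 6) * real (n * l) / 16"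
    and d: "y \<le> (alpha / 12)\<^sup>2 * real (n * l) / 8"
  defines "G \<equiv> gaussian_sample n l mu sd"
  shows "emeasure G
    ({x \<in> space G. 4 * real l * (real n * sd\<^sup>2) \<le> (\<Sum>k<l. (sum_dev n mu x k)\<^sup>2)} \<union>
     {x \<in> space G. real (n * l) * (1 + alpha / 6) \<le> sq_dev n l mu x / sd\<^sup>2} \<union>
     {x \<in> space G. alpha \<le> 12 \<and> sq_dev n l mu x / sd\<^sup>2 \<le> real (n * l) * (1 - alpha / 12)}) \<le> ennreal (3 * exp (- y))"
proof (rule emeasure_Un3_le)
  have [measurable_cong]: "sets G = sets (Pi\<^sub>M {..<n} (\<lambda>_. vec_space l))" by (simp add: G_def)
  show "{x \<in> space G. 4 * real l * (real n * sd\<^sup>2) \<le> (\<Sum>k<l. (sum_dev n mu x k)\<^sup>2)} \<in> sets G"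
    by measurable
  show "{x \<in> space G. real (n * l) * (1 + alpha / 6) \<le> sq_dev n l mu x / sd\<^sup>2} \<in> sets G"
    by measurable
  show "{x \<in> space G. alpha \<le> 12 \<and> sq_dev n l mu x / sd\<^sup>2 \<le> real (n * l) * (1 - alpha / 12)} \<in> sets G"
    by measurable
  show "emeasure G {x \<in> space G. 4 * real l * (real n * sd\<^sup>2) \<le> (\<Sum>k<l. (sum_dev n mu x k)\<^sup>2)} \<le> ennreal (exp (- y))"
    using y unfolding G_def by (intro order_trans[OF sum_dev_tail[OF p(2,1)]] ennreal_leI) simp
  show "emeasure G {x \<in> space G. real (n * l) * (1 + alpha / 6) \<le> sq_dev n l mu x / sd\<^sup>2} \<le> ennreal (exp (- y))"
    using u p unfolding G_def by (intro order_trans[OF sq_dev_upper_tail[OF p(2)]] ennreal_leI) simp_all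
  show "emeasure G {x \<in> space G. alpha \<le> 12 \<and> sq_dev n l mu x / sd\<^sup>2 \<le> real (n * l) * (1 - alpha / 12)} \<le> ennreal (exp (- y))"
  proof (cases "alpha \<le> 12")
    case True
    then have "{x \<in> space G. alpha \<le> 12 \<and> sq_dev n l mu x / sd\<^sup>2 \<le> real (n * l) * (1 - alpha / 12)} =
        {x \<in> space G. sq_dev n l mu x / sd\<^sup>2 \<le> real (n * l) * (1 - alpha / 12)}" by simp
    also have "emeasure G \<dots> \<le> ennreal (exp (- ((alpha / 12)\<^sup>2 * real (n * l) / 8)))"
      unfolding G_def using p True by (intro sq_dev_lower_tail) auto
    also have "\<dots> \<le> ennreal (exp (- y))" using d by (intro ennreal_leI) simp
    finally show ?thesis .
  qed simp
qed simp

text \<open>Disintegration of the joint law: \<open>randomized_algorithm\<close> makes the inner law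
  a measurable kernel, and \<open>return\<close> contributes the indicator.\<close>

lemma emeasure_run_on_gaussian:
  assumes K: "randomized_algorithm (vec_space l) (output_space l) M" and sd: "0 < sd"
    and B: "B \<in> sets (Pi\<^sub>M {..<n} (\<lambda>_. vec_space l) \<Otimes>\<^sub>M output_space l)"
  shows "emeasure (run_on_gaussian n l mu sd M) B =
    (\<integral>\<^sup>+ x. \<integral>\<^sup>+ z. indicator B (x, z) \<partial>M (map x [0..<n]) \<partial>gaussian_sample n l mu sd)"
    and "prob_space (run_on_gaussian n l mu sd M)"
    and "sets (run_on_gaussian n l mu sd M) = sets (Pi\<^sub>M {..<n} (\<lambda>_. vec_space l) \<Otimes>\<^sub>M output_space l)"
proof -
  let ?P = "Pi\<^sub>M {..<n} (\<lambda>_. vec_space l)"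
  let ?R = "?P \<Otimes>\<^sub>M output_space l"
  have M [measurable]: "(\<lambda>x. M (map x [0..<n])) \<in> ?P \<rightarrow>\<^sub>M prob_algebra (output_space l)"
    using K by (simp add: randomized_algorithm_def)
  have ret: "(\<lambda>z. return ?R (x, z)) \<in> output_space l \<rightarrow>\<^sub>M prob_algebra ?R" if "x \<in> space ?P" for x
    by (rule measurable_compose[OF _ measurable_return_prob_space]) (use that in measurable)
  have kernel: "(\<lambda>x. M (map x [0..<n]) \<bind> (\<lambda>z. return ?R (x, z))) \<in> ?P \<rightarrow>\<^sub>M prob_algebra ?R"
  proof (rule measurable_bind_prob_space2[OF M])
    show "(\<lambda>(x, z). return ?R (x, z)) \<in> ?P \<Otimes>\<^sub>M output_space l \<rightarrow>\<^sub>M prob_algebra ?R"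
      by (simp add: measurable_return_prob_space)
  qed
  have G: "gaussian_sample n l mu sd \<in> space (prob_algebra ?P)"
    using sd by (simp add: space_prob_algebra prob_space_gaussian_sample)
  have "emeasure (run_on_gaussian n l mu sd M) B =
      (\<integral>\<^sup>+ x. emeasure (M (map x [0..<n]) \<bind> (\<lambda>z. return ?R (x, z))) B \<partial>gaussian_sample n l mu sd)"
    unfolding run_on_gaussian_def by (rule emeasure_bind_prob_algebra[OF G kernel B])
  also have "\<dots> = (\<integral>\<^sup>+ x. \<integral>\<^sup>+ z. indicator B (x, z) \<partial>M (map x [0..<n]) \<partial>gaussian_sample n l mu sd)"
  proof (rule nn_integral_cong)
    fix x assume "x \<in> space (gaussian_sample n l mu sd)"
    then have x: "x \<in> space ?P" by simp
    have "emeasure (M (map x [0..<n]) \<bind> (\<lambda>z. return ?R (x, z))) B =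
        (\<integral>\<^sup>+ z. emeasure (return ?R (x, z)) B \<partial>M (map x [0..<n]))"
      by (rule emeasure_bind_prob_algebra[OF measurable_space[OF M x] ret[OF x] B])
    then show "emeasure (M (map x [0..<n]) \<bind> (\<lambda>z. return ?R (x, z))) B =
        (\<integral>\<^sup>+ z. indicator B (x, z) \<partial>M (map x [0..<n]))"
      using B by simp
  qed
  finally show "emeasure (run_on_gaussian n l mu sd M) B =
    (\<integral>\<^sup>+ x. \<integral>\<^sup>+ z. indicator B (x, z) \<partial>M (map x [0..<n]) \<partial>gaussian_sample n l mu sd)" .
  show "prob_space (run_on_gaussian n l mu sd M)"
    unfolding run_on_gaussian_def by (rule prob_space_bind'[OF G kernel])
  show "sets (run_on_gaussian n l mu sd M) = sets ?R"
    unfolding run_on_gaussian_def by (rule sets_bind'[OF G kernel])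
qed

definition accurate :: "nat \<Rightarrow> rvec \<Rightarrow> real \<Rightarrow> real \<Rightarrow> real \<Rightarrow> rvec \<Rightarrow> real \<Rightarrow> bool" where
  "accurate l mu sd alpha_mu alpha_sigma mu_hat sigma_hat \<longleftrightarrow>
     vec_dist l mu mu_hat \<le> alpha_mu * sd \<and>
     1 - alpha_sigma \<le> sigma_hat\<^sup>2 / sd\<^sup>2 \<and> sigma_hat\<^sup>2 / sd\<^sup>2 \<le> 1 + alpha_sigma"

text \<open>Outside the events \<open>E\<close> on the sample and \<open>F\<close> on the noise,
  accuracy is deterministic. Membership in the ball is a premise inside the event, so the tail
  bounds apply to the full Gaussian law. The choice of \<open>y\<close> gives each of the six
  exceptional events probability at most beta/10.\<close>

lemma PSGE_accurate:
  fixes l n :: nat and c mu :: rvec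
  assumes vp: "valid_params l c r alpha_mu alpha_sigma beta eps delta"
    and sd: "0 < sd" and n: "0 < n"
  defines "y \<equiv> ln (10 / beta)" and "s \<equiv> mean_noise_scale r eps delta"
  assumes dim: "8 * y \<le> real l" and size: "2 / eps * y \<le> real n / 2"
    and mu_size: "36 * real l \<le> alpha_mu\<^sup>2 * real n" "6 * r * (2 / eps * y) \<le> alpha_mu * sd * real n"
      "12 * s * sqrt (real l) \<le> alpha_mu * sd * real n"
    and sigma_size: "6 * (2 / eps * y) \<le> alpha_sigma * real n"
      "6 * (16 * r\<^sup>2 / eps * y) \<le> alpha_sigma * (real l * real n * sd\<^sup>2)" "48 \<le> alpha_sigma * real n"
      "y \<le> min (alpha_sigma / 6) 1 * (alpha_sigma / 6) * real (n * l) / 16"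
      "y \<le> (alpha_sigma / 12)\<^sup>2 * real (n * l) / 8"
  shows "1 - beta \<le> \<P>((x, mu_hat, sigma_hat) in
    run_on_gaussian n l mu sd (PSGE l c r alpha_mu alpha_sigma beta eps delta).
      (\<forall>i<n. x i \<in> vec_ball l c r) \<longrightarrow> accurate l mu sd alpha_mu alpha_sigma mu_hat sigma_hat)"
proof -
  have p: "0 < r" "0 < eps" "0 < delta" "delta < 1" "0 < alpha_mu" "0 < alpha_sigma" "0 < beta" "beta < 1" "0 < l"
    using vp by (auto simp: valid_params_def)
  have y: "0 \<le> y" "2 * y \<le> real l" "exp (- y) = beta / 10"
    using p dim by (auto simp: y_def ln_div exp_diff)
  have s: "0 < s" unfolding s_def by (rule mean_noise_scale_pos) fact+
  let ?M = "PSGE l c r alpha_mu alpha_sigma beta eps delta"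
  let ?P = "Pi\<^sub>M {..<n} (\<lambda>_. vec_space l)"
  let ?G = "gaussian_sample n l mu sd" and ?N = "noise l r eps delta"
  let ?run = "run_on_gaussian n l mu sd ?M"
  define good where "good = (\<lambda>(x :: nat \<Rightarrow> rvec, mu_hat, sigma_hat).
    (\<forall>i<n. x i \<in> vec_ball l c r) \<longrightarrow> accurate l mu sd alpha_mu alpha_sigma mu_hat sigma_hat)"
  define B where "B = {z \<in> space (?P \<Otimes>\<^sub>M output_space l). \<not> good z}"
  define E where "E = {x \<in> space ?G. 4 * real l * (real n * sd\<^sup>2) \<le> (\<Sum>k<l. (sum_dev n mu x k)\<^sup>2)} \<union>
     {x \<in> space ?G. real (n * l) * (1 + alpha_sigma / 6) \<le> sq_dev n l mu x / sd\<^sup>2} \<union>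
     {x \<in> space ?G. alpha_sigma \<le> 12 \<and> sq_dev n l mu x / sd\<^sup>2 \<le> real (n * l) * (1 - alpha_sigma / 12)}"
  define F where "F = {g \<in> space (vec_space l). 4 * real l * s\<^sup>2 \<le> (\<Sum>k<l. (g k)\<^sup>2)} \<times> (UNIV :: (real \<times> real) set) \<union>
     space (vec_space l) \<times> ({t. 2 / eps * y \<le> \<bar>t\<bar>} \<times> UNIV) \<union>
     space (vec_space l) \<times> (UNIV \<times> {t. 16 * r\<^sup>2 / eps * y \<le> \<bar>t\<bar>})"
  note run = emeasure_run_on_gaussian[OF randomized_algorithm_PSGE[OF vp] sd]
  have [measurable]: "(\<lambda>z. vec_dist l mu (fst (snd z))) \<in> borel_measurable (?P \<Otimes>\<^sub>M output_space l)"
    unfolding vec_dist_def L2_set_def by measurable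
  have good [measurable]: "Measurable.pred (?P \<Otimes>\<^sub>M output_space l) good"
    unfolding good_def accurate_def split_beta by measurable
  then have B [measurable]: "B \<in> sets (?P \<Otimes>\<^sub>M output_space l)"
    unfolding B_def by measurable
  have E [measurable]: "E \<in> sets ?G" unfolding E_def by measurable
  have F_le: "emeasure ?N F \<le> ennreal (3 * (beta / 10))"
    unfolding F_def s_def y(3)[symmetric] by (rule noise_tail[OF p(1-4) y(1,2)])
  have E_le: "emeasure ?G E \<le> ennreal (3 * (beta / 10))"
    unfolding E_def y(3)[symmetric] by (rule sample_tail[OF n sd p(6) y(2) sigma_size(4,5)])
  have accurate: "good (x, perturbed_estimate l c r (map x [0..<n]) w)"
    if x: "x \<in> space ?G" "x \<notin> E" and w: "w \<in> space ?N" "w \<notin> F" for x w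
  proof -
    obtain g a b where w_eq: "w = (g, a, b)" by (cases w)
    have noise: "(\<Sum>k<l. (g k)\<^sup>2) \<le> 4 * real l * s\<^sup>2" "\<bar>a\<bar> \<le> 2 / eps * y" "\<bar>b\<bar> \<le> 16 * r\<^sup>2 / eps * y"
      using w by (auto simp: F_def w_eq)
    have sample: "(\<Sum>k<l. (sum_dev n mu x k)\<^sup>2) \<le> 4 * real l * (real n * sd\<^sup>2)"
      "sq_dev n l mu x / sd\<^sup>2 \<le> real (n * l) * (1 + alpha_sigma / 6)"
      "alpha_sigma \<le> 12 \<Longrightarrow> real (n * l) * (1 - alpha_sigma / 12) \<le> sq_dev n l mu x / sd\<^sup>2"
      using x unfolding E_def Un_iff mem_Collect_eq by linarith+
    have lower: "real (n * l) * (1 - alpha_sigma / 12) \<le> sq_dev n l mu x / sd\<^sup>2"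
    proof (cases "alpha_sigma \<le> 12")
      case False
      then have "real (n * l) * (1 - alpha_sigma / 12) \<le> 0" by (intro mult_nonneg_nonpos) auto
      also have "0 \<le> sq_dev n l mu x / sd\<^sup>2" by (auto simp: sq_dev_def intro!: divide_nonneg_nonneg sum_nonneg)
      finally show ?thesis .
    qed (rule sample(3))
    show ?thesis
      unfolding good_def w_eq split_beta fst_conv snd_conv accurate_def
    proof (intro impI conjI)
      assume "\<forall>i<n. x i \<in> vec_ball l c r"
      then have ball: "\<And>i. i < n \<Longrightarrow> x i \<in> vec_ball l c r" by simp
      show "vec_dist l mu (fst (perturbed_estimate l c r (map x [0..<n]) (g, a, b))) \<le> alpha_mu * sd"
        by (rule mean_accuracy[OF ball n p(1) sd p(5) less_imp_le[OF s] noise(2) size mu_size(2) noise(1) mu_size(3) sample(1) mu_size(1)])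
      note var = variance_accuracy[OF ball n p(9) sd p(6) noise(2) size sigma_size(1) noise(3) sigma_size(2) sample(1) sigma_size(3) sample(2) lower]
      show "1 - alpha_sigma \<le> (snd (perturbed_estimate l c r (map x [0..<n]) (g, a, b)))\<^sup>2 / sd\<^sup>2"
        by (rule var(1))
      show "(snd (perturbed_estimate l c r (map x [0..<n]) (g, a, b)))\<^sup>2 / sd\<^sup>2 \<le> 1 + alpha_sigma"
        by (rule var(2))
    qed
  qed
  interpret G: prob_space ?G by (rule prob_space_gaussian_sample) fact
  interpret N: prob_space ?N by (rule prob_space_noise) fact+
  have inner: "(\<integral>\<^sup>+ z. indicator B (x, z) \<partial>?M (map x [0..<n])) \<le> indicator E x + ennreal (3 * (beta / 10))"
    if x: "x \<in> space ?G" for x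
  proof -
    have x': "x \<in> space ?P" using x by simp
    have "(\<lambda>z. (x, z)) \<in> output_space l \<rightarrow>\<^sub>M ?P \<Otimes>\<^sub>M output_space l"
      using x' by (rule measurable_Pair1')
    then have "(\<lambda>z. indicator B (x, z) :: ennreal) \<in> borel_measurable (output_space l)"
      by (rule measurable_compose) measurable
    then have "(\<integral>\<^sup>+ z. indicator B (x, z) \<partial>?M (map x [0..<n])) =
        (\<integral>\<^sup>+ w. indicator B (x, perturbed_estimate l c r (map x [0..<n]) w) \<partial>?N)"
      unfolding PSGE_def by (intro nn_integral_distr) auto
    \<comment> \<open>The union bound, taken pointwise: a bad output forces \<open>x\<close> into
      \<open>E\<close> or the noise into \<open>F\<close>, and \<open>F\<close> does not depend on
      \<open>x\<close>.\<close>
    also have "\<dots> \<le> (\<integral>\<^sup>+ w. indicator E x + indicator F w \<partial>?N)"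
      using accurate[OF x] by (intro nn_integral_mono) (auto simp: indicator_def B_def)
    also have "\<dots> = indicator E x + emeasure ?N F"
    proof -
      have "F = {w \<in> space ?N. 4 * real l * s\<^sup>2 \<le> (\<Sum>k<l. (fst w k)\<^sup>2) \<or>
          2 / eps * y \<le> \<bar>fst (snd w)\<bar> \<or> 16 * r\<^sup>2 / eps * y \<le> \<bar>snd (snd w)\<bar>}"
        by (auto simp: F_def)
      also have "\<dots> \<in> sets ?N" by measurable
      finally have "F \<in> sets ?N" .
      then show ?thesis using N.emeasure_space_1 by (simp add: nn_integral_add)
    qed
    also have "\<dots> \<le> indicator E x + ennreal (3 * (beta / 10))"
      by (intro add_left_mono F_le)
    finally show ?thesis .
  qed
  have "emeasure ?run B = (\<integral>\<^sup>+ x. \<integral>\<^sup>+ z. indicator B (x, z) \<partial>?M (map x [0..<n]) \<partial>?G)"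
    by (rule run(1)[OF B])
  also have "\<dots> \<le> (\<integral>\<^sup>+ x. indicator E x + ennreal (3 * (beta / 10)) \<partial>?G)"
    by (intro nn_integral_mono inner)
  also have "\<dots> = emeasure ?G E + ennreal (3 * (beta / 10))"
    using E G.emeasure_space_1 by (simp add: nn_integral_add)
  also have "\<dots> \<le> ennreal (3 * (beta / 10)) + ennreal (3 * (beta / 10))"
    by (intro add_right_mono E_le)
  also have "\<dots> \<le> ennreal beta"
    using p by (simp add: ennreal_plus[symmetric] del: ennreal_plus)
  finally have bad: "emeasure ?run B \<le> ennreal beta" .
  interpret run: prob_space ?run by (rule run(2)[OF B])
  have space_run: "space ?run = space (?P \<Otimes>\<^sub>M output_space l)"
    by (rule sets_eq_imp_space_eq[OF run(3)[OF B]])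
  have "measure ?run B \<le> beta"
    using bad p by (simp add: run.emeasure_eq_measure)
  moreover have "measure ?run (space ?run - B) = 1 - measure ?run B"
    by (rule run.prob_compl) (simp add: run(3)[OF B])
  moreover have "space ?run - B = {z \<in> space ?run. good z}"
    by (auto simp: B_def space_run)
  ultimately have "1 - beta \<le> measure ?run {z \<in> space ?run. good z}" by simp
  also have "{z \<in> space ?run. good z} = {(x, mu_hat, sigma_hat). (x, mu_hat, sigma_hat) \<in> space ?run \<and>
      ((\<forall>i<n. x i \<in> vec_ball l c r) \<longrightarrow> accurate l mu sd alpha_mu alpha_sigma mu_hat sigma_hat)}"
    by (auto simp: good_def)
  finally show ?thesis .
qed

section \<open>From the sample size to the numerical conditions\<close>

lemma ratio_bound:
  fixes n A D C C' :: real
  assumes "C * (A / D) \<le> n" "0 < D" "C' \<le> C" "0 \<le> A"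
  shows "C' * A \<le> D * n"
proof -
  have "C' * A \<le> C * A" using assms by (intro mult_right_mono)
  also have "\<dots> \<le> D * n" using assms(1,2) by (simp add: field_simps)
  finally show ?thesis .
qed

text \<open>\<open>kb\<close> and \<open>kd\<close> convert the logarithms of the proof into those
  of the rate. The constant 96 is 12 times the factor 8 in \<open>mean_noise_scale\<close>, which
  equals 8 r sqrt (...) / eps.\<close>

lemma mean_sample_size:
  fixes l :: nat and n kb kd C :: real
  assumes pos: "0 < r" "0 < alpha" "0 < eps" "0 < sd" "0 < delta" "delta < 1" "0 < beta" "beta < 1"
    and kb: "ln (10 / beta) \<le> kb * ln (1 / beta)" and kd: "eps / 4 + 2 * ln (1 / delta) \<le> kd * ln (1 / delta)"
    and C: "36 \<le> C" "12 * kb \<le> C" "96 * sqrt kd \<le> C"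
    and n: "C * mu_rate l r alpha beta eps delta sd \<le> n"
  shows "36 * real l \<le> alpha\<^sup>2 * n" "6 * r * (2 / eps * ln (10 / beta)) \<le> alpha * sd * n"
    "12 * mean_noise_scale r eps delta * sqrt (real l) \<le> alpha * sd * n"
proof -
  have L: "0 < ln (1 / beta)" "0 < ln (1 / delta)" using pos by auto
  have terms: "0 \<le> real l / alpha\<^sup>2" "0 \<le> ln (1 / beta) / alpha\<^sup>2"
    "0 \<le> r * ln (1 / beta) / (alpha * eps * sd)" "0 \<le> r * sqrt (real l * ln (1 / delta)) / (alpha * eps * sd)"
    using pos L by (auto simp del: ln_div)
  have part: "C * t \<le> n" if "t \<le> mu_rate l r alpha beta eps delta sd" for t
    using mult_left_mono[OF that, of C] C(1) n by linarith
  have parts: "C * (real l / alpha\<^sup>2) \<le> n" "C * (r * ln (1 / beta) / (alpha * eps * sd)) \<le> n"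
    "C * (r * sqrt (real l * ln (1 / delta)) / (alpha * eps * sd)) \<le> n"
    using terms by (intro part; simp add: mu_rate_def)+
  show "36 * real l \<le> alpha\<^sup>2 * n"
    by (rule ratio_bound[OF parts(1)]) (use pos C in auto)
  have "12 * kb * (r * ln (1 / beta)) \<le> alpha * eps * sd * n"
    by (rule ratio_bound[OF parts(2)]) (use pos C L in \<open>auto simp del: ln_div\<close>)
  moreover have "12 * r * ln (10 / beta) \<le> 12 * r * (kb * ln (1 / beta))"
    using kb pos by (intro mult_left_mono) auto
  ultimately have "12 * r * ln (10 / beta) \<le> alpha * sd * n * eps" by (simp add: mult_ac)
  then show "6 * r * (2 / eps * ln (10 / beta)) \<le> alpha * sd * n"
    using pos by (simp add: pos_divide_le_eq mult_ac)
  have "96 * sqrt kd * (r * sqrt (real l * ln (1 / delta))) \<le> alpha * eps * sd * n"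
    by (rule ratio_bound[OF parts(3)]) (use pos C L in \<open>auto simp del: ln_div\<close>)
  moreover have "sqrt (eps / 4 + 2 * ln (1 / delta)) * sqrt (real l) \<le> sqrt kd * sqrt (real l * ln (1 / delta))"
    using real_sqrt_le_mono[OF mult_right_mono[OF kd, of "real l"]]
    by (simp add: real_sqrt_mult mult_ac del: ln_div)
  then have "96 * r * (sqrt (eps / 4 + 2 * ln (1 / delta)) * sqrt (real l)) \<le>
      96 * r * (sqrt kd * sqrt (real l * ln (1 / delta)))"
    using pos by (intro mult_left_mono) auto
  ultimately have "96 * r * (sqrt (eps / 4 + 2 * ln (1 / delta)) * sqrt (real l)) \<le> alpha * sd * n * eps"
    by (simp add: mult_ac del: ln_div)
  moreover have "12 * mean_noise_scale r eps delta * sqrt (real l) =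
      96 * r * (sqrt (eps / 4 + 2 * ln (1 / delta)) * sqrt (real l)) / eps"
    by (simp add: mean_noise_scale_def mult_ac del: ln_div)
  ultimately show "12 * mean_noise_scale r eps delta * sqrt (real l) \<le> alpha * sd * n"
    using pos by (simp add: pos_divide_le_eq del: ln_div)
qed

text \<open>Two conditions lack the factor 1/eps of the second summand of the rate:
  \<open>48 \<le> alpha * n\<close>, and the upper tail for \<open>alpha\<close> above 6, where the
  exponent is linear in \<open>alpha\<close>. Both are drawn from that summand, which is why
  \<open>eps_max\<close> and \<open>Lm\<close> enter \<open>C\<close>.\<close>

lemma variance_sample_size:
  fixes l :: nat and n kb C eps_max Lm :: real
  assumes pos: "0 < r" "0 < alpha" "0 < eps" "0 < sd" "0 < beta" "beta < 1" "0 < l"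
    and kb: "ln (10 / beta) \<le> kb * ln (1 / beta)" "0 \<le> kb"
    and em: "eps \<le> eps_max" and Lm: "0 < Lm" "Lm \<le> ln (1 / beta)"
    and C: "1152 * kb \<le> C" "96 * kb * eps_max \<le> C" "48 * eps_max / Lm \<le> C"
    and n: "C * sigma_rate l r alpha beta eps sd \<le> n"
  defines "y \<equiv> ln (10 / beta)"
  shows "6 * (2 / eps * y) \<le> alpha * n" "6 * (16 * r\<^sup>2 / eps * y) \<le> alpha * (real l * n * sd\<^sup>2)"
    "48 \<le> alpha * n" "y \<le> min (alpha / 6) 1 * (alpha / 6) * (n * real l) / 16"
    "y \<le> (alpha / 12)\<^sup>2 * (n * real l) / 8"
proof -
  define L where "L = ln (1 / beta)"
  have L: "0 < L" "Lm \<le> L" using Lm by (auto simp: L_def)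
  have yL: "y \<le> kb * L" using kb by (simp add: y_def L_def)
  have C0: "0 \<le> C" using C(1) kb by linarith
  have terms: "0 \<le> L / (alpha\<^sup>2 * real l)" "0 \<le> L / (alpha * eps)" "0 \<le> r\<^sup>2 * L / (alpha * eps * sd\<^sup>2 * real l)"
    using pos L by auto
  have part: "C * t \<le> n" if "t \<le> sigma_rate l r alpha beta eps sd" for t
    using mult_left_mono[OF that C0] n by simp
  have parts: "C * (L / (alpha\<^sup>2 * real l)) \<le> n" "C * (L / (alpha * eps)) \<le> n"
    "C * (r\<^sup>2 * L / (alpha * eps * sd\<^sup>2 * real l)) \<le> n"
    using terms by (intro part; simp add: sigma_rate_def L_def[symmetric])+
  have p1: "C' * L \<le> alpha\<^sup>2 * real l * n" if "C' \<le> C" for C'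
    by (rule ratio_bound[OF parts(1)]) (use pos L that in auto)
  have p2: "C' * L \<le> alpha * eps * n" if "C' \<le> C" for C'
    by (rule ratio_bound[OF parts(2)]) (use pos L that in auto)
  have p3: "C' * (r\<^sup>2 * L) \<le> alpha * eps * sd\<^sup>2 * real l * n" if "C' \<le> C" for C'
    by (rule ratio_bound[OF parts(3)]) (use pos L that in auto)
  have n0: "0 \<le> n" using parts(1) terms(1) C0 by (meson mult_nonneg_nonneg order_trans)
  have em0: "0 < eps_max" using em pos by simp
  \<comment> \<open>Trades the factor \<open>eps\<close> for the constant
    \<open>eps_max\<close>.\<close>
  have p2': "C' * L \<le> alpha * n" if "C' * eps_max \<le> C" for C'
  proof -
    have "C' * eps_max * L \<le> alpha * eps * n" by (rule p2) fact
    also have "\<dots> \<le> alpha * eps_max * n" using em pos n0 by (intro mult_right_mono mult_left_mono) auto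
    finally have "eps_max * (C' * L) \<le> eps_max * (alpha * n)" by (simp add: mult_ac)
    then show ?thesis using em0 by simp
  qed
  have kbC: "12 * kb \<le> C" "96 * kb \<le> C" "576 * kb \<le> C" using C(1) kb(2) by linarith+
  have "12 * y \<le> alpha * n * eps" using p2[OF kbC(1)] yL by (simp add: mult_ac)
  then show "6 * (2 / eps * y) \<le> alpha * n" using pos by (simp add: pos_divide_le_eq)
  have "r\<^sup>2 * y \<le> r\<^sup>2 * (kb * L)" using yL by (intro mult_left_mono) auto
  then have "96 * (r\<^sup>2 * y) \<le> alpha * (real l * n * sd\<^sup>2) * eps" using p3[OF kbC(2)] by (simp add: mult_ac)
  then show "6 * (16 * r\<^sup>2 / eps * y) \<le> alpha * (real l * n * sd\<^sup>2)" using pos by (simp add: pos_divide_le_eq mult_ac)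
  have "48 / Lm * L \<le> alpha * n" by (rule p2') (use C(3) in simp)
  moreover have "48 \<le> 48 / Lm * L" using L Lm by (simp add: field_simps)
  ultimately show "48 \<le> alpha * n" by simp
  have "1152 * y \<le> alpha\<^sup>2 * real l * n" using p1[OF C(1)] yL by simp
  then show "y \<le> (alpha / 12)\<^sup>2 * (n * real l) / 8"
    by (simp add: power_divide mult_ac)
  show "y \<le> min (alpha / 6) 1 * (alpha / 6) * (n * real l) / 16"
  proof (cases "alpha / 6 \<le> 1")
    case True
    have "576 * y \<le> alpha\<^sup>2 * real l * n" using p1[OF kbC(3)] yL by simp
    then show ?thesis using True by (simp add: power2_eq_square mult_ac)
  next
    case False
    have "96 * y \<le> alpha * n" using p2'[of "96 * kb"] C(2) yL by (simp add: mult_ac)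
    also have "\<dots> = alpha * n * 1" by simp
    also have "\<dots> \<le> alpha * n * real l" using pos n0 by (intro mult_left_mono) auto
    finally show ?thesis using False by (simp add: mult_ac)
  qed
qed

text \<open>The explicit summand of the sample size suffices with its own constants: 6 ln (5/beta)
  dominates 4 ln (10/beta), because 10^2 is at most 5^3 and ln beta is negative.\<close>

lemma count_sample_size:
  fixes n :: real
  assumes "0 < eps" "0 < beta" "beta < 1" "6 * ln (5 / beta) / eps \<le> n"
  shows "2 / eps * ln (10 / beta) \<le> n / 2"
proof -
  have "ln (10 ^ 2) \<le> ln (5 ^ 3 :: real)" by simp
  then have "2 * ln 10 \<le> 3 * ln (5 :: real)" by (simp only: ln_realpow zero_less_numeral of_nat_numeral)
  moreover have "ln beta < 0" "ln (10 / beta) = ln 10 - ln beta" "ln (5 / beta) = ln 5 - ln beta"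
    using assms by (simp_all add: ln_div)
  ultimately have "4 * ln (10 / beta) \<le> 6 * ln (5 / beta)" by linarith
  also have "\<dots> \<le> n * eps" using assms by (simp add: pos_divide_le_eq)
  finally show ?thesis using assms(1) by (simp add: pos_divide_le_eq)
qed

theorem theorem4p14:
  shows "\<exists>PSGE :: nat \<Rightarrow> rvec \<Rightarrow> real \<Rightarrow> real \<Rightarrow> real \<Rightarrow> real \<Rightarrow> real \<Rightarrow> real \<Rightarrow>
                 rvec list \<Rightarrow> (rvec \<times> real) measure.
    (\<forall>l c r alpha_mu alpha_sigma beta eps delta.
       valid_params l c r alpha_mu alpha_sigma beta eps delta \<longrightarrow>
       randomized_algorithm (vec_space l) (output_space l)
         (PSGE l c r alpha_mu alpha_sigma beta eps delta) \<and>
       differentially_private (vec_space l) (output_space l) eps delta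
         (PSGE l c r alpha_mu alpha_sigma beta eps delta)) \<and>
    (\<forall>eps_max beta_max delta_max :: real.
       0 < eps_max \<and> beta_max < 1 \<and> delta_max < 1 \<longrightarrow>
       (\<exists>C_mu > 0. \<exists>C_sigma > 0.
          \<forall>l c r alpha_mu alpha_sigma beta eps delta mu sd n.
            valid_params l c r alpha_mu alpha_sigma beta eps delta \<and>
            eps \<le> eps_max \<and> beta \<le> beta_max \<and> delta \<le> delta_max \<and>
            mu \<in> space (vec_space l) \<and> 0 < sd \<and>
            real n \<ge> 6 * ln (5 / beta) / eps
                     + C_mu * mu_rate l r alpha_mu beta eps delta sd
                     + C_sigma * sigma_rate l r alpha_sigma beta eps sd
            \<longrightarrow>
            \<P>((x, mu_hat, sigma_hat) in
                run_on_gaussian n l mu sd (PSGE l c r alpha_mu alpha_sigma beta eps delta).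
                (\<forall>i<n. x i \<in> vec_ball l c r) \<and> real l \<ge> 8 * ln (10 / beta) \<longrightarrow>
                vec_dist l mu mu_hat \<le> alpha_mu * sd \<and>
                1 - alpha_sigma \<le> sigma_hat\<^sup>2 / sd\<^sup>2 \<and>
                sigma_hat\<^sup>2 / sd\<^sup>2 \<le> 1 + alpha_sigma)
            \<ge> 1 - beta))"
proof (intro exI[of _ PSGE] conjI allI impI)
  fix l c r alpha_mu alpha_sigma beta eps delta
  assume vp: "valid_params l c r alpha_mu alpha_sigma beta eps delta"
  show "randomized_algorithm (vec_space l) (output_space l) (PSGE l c r alpha_mu alpha_sigma beta eps delta)"
    by (rule randomized_algorithm_PSGE[OF vp])
  show "differentially_private (vec_space l) (output_space l) eps delta (PSGE l c r alpha_mu alpha_sigma beta eps delta)"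
    by (rule differentially_private_PSGE[OF vp])
next
  fix eps_max beta_max delta_max :: real
  assume bounds: "0 < eps_max \<and> beta_max < 1 \<and> delta_max < 1"
  \<comment> \<open>\<open>beta_max\<close> may be 0 or negative. The maximum with 1/2 keeps the
    argument inside (0, 1), so that \<open>Lb\<close> is a positive lower bound of ln (1/beta);
    \<open>Ld\<close> is built likewise for \<open>delta\<close>.\<close>
  define Lb where "Lb = ln (1 / max beta_max (1 / 2))"
  define Ld where "Ld = ln (1 / max delta_max (1 / 2))"
  \<comment> \<open>From ln (10/beta) = ln 10 + ln (1/beta), where ln 10 is at most
    \<open>ln 10 / Lb\<close> times ln (1/beta). In \<open>kd\<close> the summand
    \<open>eps / 4\<close> is absorbed into ln (1/delta) in the same way.\<close>
  define kb where "kb = 1 + ln 10 / Lb"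
  define kd where "kd = 2 + eps_max / (4 * Ld)"
  define C_mu where "C_mu = 36 + 12 * kb + 96 * sqrt kd"
  define C_sigma where "C_sigma = 1152 * kb + 96 * kb * eps_max + 48 * eps_max / Lb"
  have Lb: "0 < Lb" unfolding Lb_def using bounds by (intro ln_gt_zero) (auto simp: max_def)
  have Ld: "0 < Ld" unfolding Ld_def using bounds by (intro ln_gt_zero) (auto simp: max_def)
  have kb: "0 < kb" using Lb by (auto simp: kb_def intro: add_pos_nonneg)
  have kd: "0 < kd" using Ld bounds by (auto simp: kd_def intro: add_pos_nonneg)
  have C_mu: "0 < C_mu" "36 \<le> C_mu" "12 * kb \<le> C_mu" "96 * sqrt kd \<le> C_mu"
    using kb kd by (auto simp: C_mu_def intro!: add_pos_nonneg)
  have "0 < kb * eps_max" "0 < eps_max / Lb" using kb Lb bounds by auto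
  then have C_sigma: "0 < C_sigma" "1152 * kb \<le> C_sigma" "96 * kb * eps_max \<le> C_sigma" "48 * eps_max / Lb \<le> C_sigma"
    using kb by (auto simp: C_sigma_def)
  have ln_le: "Lt \<le> ln (1 / t)" if "0 < t" "t \<le> t_max" "t_max < 1" "Lt = ln (1 / max t_max (1 / 2))" for t t_max Lt :: real
    unfolding that(4) using that(1-3) by (intro ln_mono divide_left_mono) (auto simp: max_def)
  show "\<exists>C_mu > 0. \<exists>C_sigma > 0.
          \<forall>l c r alpha_mu alpha_sigma beta eps delta mu sd n.
            valid_params l c r alpha_mu alpha_sigma beta eps delta \<and>
            eps \<le> eps_max \<and> beta \<le> beta_max \<and> delta \<le> delta_max \<and>
            mu \<in> space (vec_space l) \<and> 0 < sd \<and>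
            real n \<ge> 6 * ln (5 / beta) / eps
                     + C_mu * mu_rate l r alpha_mu beta eps delta sd
                     + C_sigma * sigma_rate l r alpha_sigma beta eps sd
            \<longrightarrow>
            \<P>((x, mu_hat, sigma_hat) in
                run_on_gaussian n l mu sd (PSGE l c r alpha_mu alpha_sigma beta eps delta).
                (\<forall>i<n. x i \<in> vec_ball l c r) \<and> real l \<ge> 8 * ln (10 / beta) \<longrightarrow>
                vec_dist l mu mu_hat \<le> alpha_mu * sd \<and>
                1 - alpha_sigma \<le> sigma_hat\<^sup>2 / sd\<^sup>2 \<and>
                sigma_hat\<^sup>2 / sd\<^sup>2 \<le> 1 + alpha_sigma)
            \<ge> 1 - beta"
  proof (rule exI[of _ C_mu], rule conjI[OF C_mu(1)], rule exI[of _ C_sigma], rule conjI[OF C_sigma(1)],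
      intro allI impI, elim conjE)
    fix l n :: nat and c mu :: rvec and r alpha_mu alpha_sigma beta eps delta sd :: real
    assume vp: "valid_params l c r alpha_mu alpha_sigma beta eps delta"
      and le: "eps \<le> eps_max" "beta \<le> beta_max" "delta \<le> delta_max" and sd: "0 < sd"
      and n: "real n \<ge> 6 * ln (5 / beta) / eps + C_mu * mu_rate l r alpha_mu beta eps delta sd
        + C_sigma * sigma_rate l r alpha_sigma beta eps sd"
    let ?run = "run_on_gaussian n l mu sd (PSGE l c r alpha_mu alpha_sigma beta eps delta)"
    have p: "0 < r" "0 < alpha_mu" "0 < alpha_sigma" "0 < eps" "0 < delta" "delta < 1" "0 < beta" "beta < 1" "0 < l"
      using vp by (auto simp: valid_params_def)
    have L_beta: "Lb \<le> ln (1 / beta)" by (rule ln_le[OF p(7) le(2)]) (use bounds Lb_def in auto)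
    have L_delta: "Ld \<le> ln (1 / delta)" by (rule ln_le[OF p(5) le(3)]) (use bounds Ld_def in auto)
    have "ln 10 * 1 \<le> ln 10 * (ln (1 / beta) / Lb)"
      using L_beta Lb by (intro mult_left_mono) auto
    moreover have "ln (10 / beta) = ln 10 + ln (1 / beta)" using p by (simp add: ln_div)
    ultimately have kb_le: "ln (10 / beta) \<le> kb * ln (1 / beta)"
      unfolding kb_def distrib_right by simp
    have "eps / 4 * 1 \<le> eps_max / 4 * (ln (1 / delta) / Ld)"
      using L_delta Ld le p by (intro mult_mono) auto
    then have kd_le: "eps / 4 + 2 * ln (1 / delta) \<le> kd * ln (1 / delta)"
      unfolding kd_def distrib_right by simp
    have "0 < ln (1 / beta)" "0 < ln (1 / delta)" using L_beta L_delta Lb Ld by linarith+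
    then have rates: "0 \<le> mu_rate l r alpha_mu beta eps delta sd" "0 \<le> sigma_rate l r alpha_sigma beta eps sd"
      unfolding mu_rate_def sigma_rate_def using p sd by (auto intro!: add_nonneg_nonneg simp del: ln_div)
    have count: "0 < 6 * ln (5 / beta) / eps" using p by simp
    have n_parts: "6 * ln (5 / beta) / eps \<le> real n" "C_mu * mu_rate l r alpha_mu beta eps delta sd \<le> real n"
      "C_sigma * sigma_rate l r alpha_sigma beta eps sd \<le> real n" and n0: "0 < n"
      using n count rates mult_nonneg_nonneg[OF less_imp_le[OF C_mu(1)] rates(1)]
        mult_nonneg_nonneg[OF less_imp_le[OF C_sigma(1)] rates(2)] by auto
    show "1 - beta \<le> \<P>((x, mu_hat, sigma_hat) in ?run.
        (\<forall>i<n. x i \<in> vec_ball l c r) \<and> real l \<ge> 8 * ln (10 / beta) \<longrightarrow>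
        vec_dist l mu mu_hat \<le> alpha_mu * sd \<and>
        1 - alpha_sigma \<le> sigma_hat\<^sup>2 / sd\<^sup>2 \<and> sigma_hat\<^sup>2 / sd\<^sup>2 \<le> 1 + alpha_sigma)"
    \<comment> \<open>The dimension condition does not involve the sample or the output: if it
      fails, the implication holds everywhere and the event has probability 1.\<close>
    proof (cases "8 * ln (10 / beta) \<le> real l")
      case True
      note mean = mean_sample_size[OF p(1,2,4) sd p(5-8) kb_le kd_le C_mu(2-4) n_parts(2)]
      note var = variance_sample_size[OF p(1,3,4) sd p(7-9) kb_le less_imp_le[OF kb] le(1) Lb L_beta C_sigma(2-4) n_parts(3)]
      have "1 - beta \<le> \<P>((x, mu_hat, sigma_hat) in ?run.
          (\<forall>i<n. x i \<in> vec_ball l c r) \<longrightarrow> accurate l mu sd alpha_mu alpha_sigma mu_hat sigma_hat)"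
        by (rule PSGE_accurate[OF vp sd n0 True count_sample_size[OF p(4,7,8) n_parts(1)] mean var(1-3)
              var(4,5)[folded of_nat_mult]])
      then show ?thesis using True by (simp add: accurate_def)
    next
      case False
      interpret prob_space ?run
        by (rule emeasure_run_on_gaussian(2)[OF randomized_algorithm_PSGE[OF vp] sd sets.empty_sets])
      show ?thesis using False p prob_space by (simp add: split_beta)
    qed
  qed
qed

end
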